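(* Let $\theta\in(0,1]$, $r>1$, and let $\{Z_n\}_{n\ge0}$ be a (possibly defective) GW$^{\,\theta}$-process with parameters $(\theta,r,a_n,c_n)_{n\ge1}$. Then $$q=r-(Ar^{-\theta}+C)^{-1/\theta},\quad q_\Delta=1-r+(A(r-1)^{-\theta}+C)^{-1/\theta},$$ where $A=\lim_{n\to\infty}A_n\in[0,1)$ and $C=\lim_{n\to\infty}C_n$ satisfies $(1-A)r^{-\theta}\le C\le(1-A)(r-1)^{-\theta}$. (i) If $A=0$, then $q=1-q_\Delta=r-C^{-1/\theta}\in[0,1]$, so that $Q=1$. Furthermore, $$A_n^{-1}\mathrm{P}(\tau>n)\to((r-1)^{-\theta}-r^{-\theta})\,\theta^{-1}C^{-1/\theta-1},$$ $$\mathrm{E}(Z_n|\tau>n)\to\frac{(r-1)^{-\theta-1}}{(r-1)^{-\theta}-r^{-\theta}},\qquad \mathrm{E}(s^{Z_n}|\tau>n)\to\frac{(r-s)^{-\theta}-r^{-\theta}}{(r-1)^{-\theta}-r^{-\theta}},\quad 0\le s\le1.$$ (ii) If $A\in(0,1)$, then $Q\in[0,1)$, $$\mathrm{E}(Z_n;\tau_\Delta>n)\to A(A+C(r-1)^\theta)^{-1/\theta-1},$$ and $Z_n$ converges almost surely to a random variable $Z_\infty$ taking values in the set $\{\Delta,0,1,2,\ldots\}$, with $$\mathrm{P}(Z_\infty=\Delta)=1-r+(A(r-1)^{-\theta}+C)^{-1/\theta},$$ $$\mathrm{E}(s^{Z_\infty};Z_\infty\ne\Delta)=r-(A(r-s)^{-\theta}+C)^{-1/\theta},\quad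 0\le s\le1.$$
   Context: All limits are as $n\to\infty$. Let $\theta\in(0,1]$, $r>1$, and let $(a_n,c_n)_{n\ge1}$ be real sequences with $0<a_n<1$ and $(1-a_n)r^{-\theta}\le c_n\le(1-a_n)(r-1)^{-\theta}$ for all $n\ge1$. Put $$f_n(s)=r-(a_n(r-s)^{-\theta}+c_n)^{-1/\theta},\quad 0\le s\le1.$$ Each $f_n(s)=\sum_{j\ge0}p_n(j)s^j$ is a possibly defective probability generating function: $p_n(j)\ge0$ and $f_n(1)\le1$. The GW$^{\,\theta}$-process with parameters $(\theta,r,a_n,c_n)_{n\ge1}$ is the Galton-Watson process in a varying environment with $Z_0=1$, in which each individual of generation $n-1$, independently of everything else, has $j$ offspring with probability $p_n(j)$, $j\ge0$, and with the remaining probability $1-f_n(1)$ sends the entire process to an additional absorbing state $\Delta$ at time $n$ (so $Z_n=\Delta$ if some individual of generation $n-1$ does so, or if $Z_{n-1}=\Delta$; otherwise $Z_n$ is the total number of offspring). The state $0$ is also absorbing. With $F_n=f_1\circ\cdots\circ f_n$, one has $\mathrm{E}(s^{Z_n};Z_n\ne\Delta)=F_n(s)$, $\mathrm{P}(Z_n=0)=F_n(0)$, $\mathrm{P}(Z_n=\Delta)=1-F_n(1)$. Notation: $\mathrm{E}(X;E)$ is the expectation of $X$ times the indicator of the event $E$. $\tau_0$ and $\tau_\Delta$ are the absorption times at $0$ and at $\Delta$ respectively, $\tau=\min(\tau_0,\tau_\Delta)$, $q=\mathrm{P}(\tau_0<\infty)$, $q_\Delta=\mathrm{P}(\tau_\Delta<\infty)$,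 $Q=\mathrm{P}(\tau<\infty)=q+q_\Delta$. $A_0=1$, $A_n=\prod_{i=1}^na_i$, $C_n=\sum_{i=1}^nA_{i-1}c_i$.
   Formalization: In (i), the limit of E(Z_n | τ>n) is stated and proved with an additional factor θ, as θ(r-1)^{-θ-1}/((r-1)^{-θ}-r^{-θ}); the printed formula without θ is false for θ<1 and agrees for θ=1. *)

theory Defs
  imports "HOL-Probability.Probability"
begin

definition gw_f :: "real \<Rightarrow> real \<Rightarrow> real \<Rightarrow> real \<Rightarrow> real \<Rightarrow> real" where
  "gw_f \<theta> r a c s = r - (a * (r - s) powr (- \<theta>) + c) powr (- 1 / \<theta>)"

definition A_seq :: "(nat \<Rightarrow> real) \<Rightarrow> nat \<Rightarrow> real" where
  "A_seq a n = (\<Prod>i=1..n. a i)"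

definition C_seq :: "(nat \<Rightarrow> real) \<Rightarrow> (nat \<Rightarrow> real) \<Rightarrow> nat \<Rightarrow> real" where
  "C_seq a c n = (\<Sum>i=1..n. A_seq a (i - 1) * c i)"

text \<open>
  The state space \<open>{\<Delta>, 0, 1, 2, \<dots>}\<close> is \<open>nat option\<close>, with \<open>None\<close> in the role of \<open>\<Delta>\<close>.
  The variable \<open>\<xi> n i\<close> is the outcome of the \<open>i\<close>-th individual of generation \<open>n - 1\<close>: either
  \<open>Some j\<close> (it has \<open>j\<close> offspring) or \<open>None\<close> (it sends the whole process to \<open>\<Delta>\<close>).  The assumption
  \<open>pgf\<close> determines \<open>p n\<close> as the sequence of power series coefficients of \<open>f\<^sub>n\<close>; together with
  \<open>offspring\<close> it gives \<open>p n j \<ge> 0\<close> and probability \<open>1 - f\<^sub>n(1)\<close> for the outcome \<open>None\<close>.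
  Index \<open>0\<close> of \<open>a\<close>, \<open>c\<close>, \<open>p\<close> and \<open>\<xi>\<close> is unused.
\<close>

locale gw_theta_process = prob_space M for M :: "'w measure" +
  fixes \<theta> r :: real
    and a c :: "nat \<Rightarrow> real"
    and p :: "nat \<Rightarrow> nat \<Rightarrow> real"
    and \<xi> :: "nat \<Rightarrow> nat \<Rightarrow> 'w \<Rightarrow> nat option"
    and Z :: "nat \<Rightarrow> 'w \<Rightarrow> nat option"
  assumes theta: "0 < \<theta>" "\<theta> \<le> 1"
    and r: "1 < r"
    and a: "\<And>n. 1 \<le> n \<Longrightarrow> 0 < a n \<and> a n < 1"
    and c: "\<And>n. 1 \<le> n \<Longrightarrow>
          (1 - a n) * r powr (- \<theta>) \<le> c n \<and> c n \<le> (1 - a n) * (r - 1) powr (- \<theta>)"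
    and pgf: "\<And>n s. 1 \<le> n \<Longrightarrow> 0 \<le> s \<Longrightarrow> s \<le> 1 \<Longrightarrow>
          (\<lambda>j. p n j * s ^ j) sums gw_f \<theta> r (a n) (c n) s"
    and indep: "indep_vars (\<lambda>_. count_space UNIV) (\<lambda>(n, i). \<xi> n i) ({1..} \<times> UNIV)"
    and offspring: "\<And>n i j. 1 \<le> n \<Longrightarrow> prob {\<omega> \<in> space M. \<xi> n i \<omega> = Some j} = p n j"
    and Z_0: "\<And>\<omega>. \<omega> \<in> space M \<Longrightarrow> Z 0 \<omega> = Some 1"
    and Z_Suc: "\<And>n \<omega>. \<omega> \<in> space M \<Longrightarrow> Z (Suc n) \<omega> =
          (case Z n \<omega> of
             None \<Rightarrow> None
           | Some k \<Rightarrow>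
               if \<exists>i<k. \<xi> (Suc n) i \<omega> = None then None
               else Some (\<Sum>i<k. the (\<xi> (Suc n) i \<omega>)))"

text \<open>The infimum of the empty set is \<open>\<infinity>\<close>.\<close>

definition hit_time :: "(nat \<Rightarrow> 'w \<Rightarrow> 's) \<Rightarrow> 's \<Rightarrow> 'w \<Rightarrow> enat" where
  "hit_time Z x \<omega> = (INF n \<in> {n. Z n \<omega> = x}. enat n)"

definition tau_0 :: "(nat \<Rightarrow> 'w \<Rightarrow> nat option) \<Rightarrow> 'w \<Rightarrow> enat" where
  "tau_0 Z = hit_time Z (Some 0)"

definition tau_Delta :: "(nat \<Rightarrow> 'w \<Rightarrow> nat option) \<Rightarrow> 'w \<Rightarrow> enat" where
  "tau_Delta Z = hit_time Z None"

definition tau :: "(nat \<Rightarrow> 'w \<Rightarrow> nat option) \<Rightarrow> 'w \<Rightarrow> enat" where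
  "tau Z \<omega> = min (tau_0 Z \<omega>) (tau_Delta Z \<omega>)"

definition ext_prob :: "'w measure \<Rightarrow> (nat \<Rightarrow> 'w \<Rightarrow> nat option) \<Rightarrow> real" where
  "ext_prob M Z = measure M {\<omega> \<in> space M. tau_0 Z \<omega> < \<infinity>}"

definition Delta_prob :: "'w measure \<Rightarrow> (nat \<Rightarrow> 'w \<Rightarrow> nat option) \<Rightarrow> real" where
  "Delta_prob M Z = measure M {\<omega> \<in> space M. tau_Delta Z \<omega> < \<infinity>}"

definition absorb_prob :: "'w measure \<Rightarrow> (nat \<Rightarrow> 'w \<Rightarrow> nat option) \<Rightarrow> real" where
  "absorb_prob M Z = measure M {\<omega> \<in> space M. tau Z \<omega> < \<infinity>}"

definition exp_on :: "'w measure \<Rightarrow> ('w \<Rightarrow> real) \<Rightarrow> ('w \<Rightarrow> bool) \<Rightarrow> real" where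
  "exp_on M X E = (LINT \<omega>:{\<omega> \<in> space M. E \<omega>}|M. X \<omega>)"

text \<open>
  Expectation conditional on an event.  In the limit theorem the conditional mean of \<open>Z n\<close> given
  \<open>tau > n\<close> tends to \<open>\<theta> (r - 1)\<^bsup>-\<theta>-1\<^esup> / ((r - 1)\<^bsup>-\<theta>\<^esup> - r\<^bsup>-\<theta>\<^esup>)\<close>, the derivative at \<open>s = 1\<close> of
  the limiting conditional generating function; a version of this formula without the factor
  \<open>\<theta>\<close> is correct only for \<open>\<theta> = 1\<close>.
\<close>

definition cond_exp_on :: "'w measure \<Rightarrow> ('w \<Rightarrow> real) \<Rightarrow> ('w \<Rightarrow> bool) \<Rightarrow> real" where
  "cond_exp_on M X E = exp_on M X E / measure M {\<omega> \<in> space M. E \<omega>}"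

end

theory Submission
  imports Defs
begin

text \<open>
  Since \<open>(r - f\<^sub>n s)\<^bsup>-\<theta>\<^esup> = a\<^sub>n (r - s)\<^bsup>-\<theta>\<^esup> + c\<^sub>n\<close>, the map \<open>s \<mapsto> (r - s)\<^bsup>-\<theta>\<^esup>\<close> turns the generating functions
  into affine maps, so the generating function of \<open>Z\<^sub>n\<close> is \<open>gw_f\<close> with parameters \<open>A\<^sub>n\<close>, \<open>C\<^sub>n\<close>. The
  absorption probabilities and the conditional limits are read off by letting \<open>n \<rightarrow> \<infinity>\<close>, after
  expanding to first order in \<open>A\<^sub>n\<close> when \<open>A = 0\<close>; the mean is the left derivative at \<open>1\<close>. When
  \<open>A > 0\<close> the means are bounded and \<open>\<Sum> (1 - a\<^sub>n) < \<infinity>\<close>, while \<open>1 - p\<^sub>n(1) = O(1 - a\<^sub>n)\<close>, so the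
  probabilities of \<open>Z\<^bsub>n+1\<^esub> \<noteq> Z\<^sub>n\<close> are summable and almost surely only finitely many changes occur.
\<close>

subsection \<open>Generating functions\<close>


text \<open>Dominated convergence for the partial sums over the values of \<open>X\<close>. The
  summand \<open>h j\<close> may itself be random, so that products over the individuals of a
  generation of random size are covered; the outcome \<open>None\<close> contributes 0.\<close>

lemma (in prob_space) option_expectation_sums:
  fixes X :: "'a \<Rightarrow> nat option" and h :: "nat \<Rightarrow> 'a \<Rightarrow> real"
  assumes X [measurable]: "X \<in> measurable M (count_space UNIV)"
    and h [measurable]: "\<And>j. h j \<in> borel_measurable M"
    and bound: "\<And>j \<omega>. \<omega> \<in> space M \<Longrightarrow> \<bar>h j \<omega>\<bar> \<le> 1"
  shows "(\<lambda>j. expectation (\<lambda>\<omega>. if X \<omega> = Some j then h j \<omega> else 0)) sums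
    expectation (\<lambda>\<omega>. case X \<omega> of None \<Rightarrow> 0 | Some j \<Rightarrow> h j \<omega>)"
proof -
  define S where "S N \<omega> = (\<Sum>j<N. if X \<omega> = Some j then h j \<omega> else 0)" for N \<omega>
  have S: "S N \<omega> = (case X \<omega> of None \<Rightarrow> 0 | Some j \<Rightarrow> if j < N then h j \<omega> else 0)" for N \<omega>
    by (auto simp: S_def sum.delta split: option.split)
  have int: "integrable M (\<lambda>\<omega>. if X \<omega> = Some j then h j \<omega> else 0)" for j
    by (rule integrable_const_bound[where B = 1]) (auto simp: bound)
  have "(\<lambda>N. expectation (S N)) \<longlonglongrightarrow> expectation (\<lambda>\<omega>. case X \<omega> of None \<Rightarrow> 0 | Some j \<Rightarrow> h j \<omega>)"
  proof (rule integral_dominated_convergence[where w = "\<lambda>_. 1"])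
    show "(\<lambda>\<omega>. case X \<omega> of None \<Rightarrow> 0 | Some j \<Rightarrow> h j \<omega>) \<in> borel_measurable M"
    proof (rule measurable_compose_countable[OF _ X])
      show "random_variable borel (\<lambda>\<omega>. case z of None \<Rightarrow> 0 | Some j \<Rightarrow> h j \<omega>)" for z
        by (cases z) simp_all
    qed
    show "S N \<in> borel_measurable M" for N
      unfolding S_def by measurable
    show "AE \<omega> in M. (\<lambda>N. S N \<omega>) \<longlonglongrightarrow> (case X \<omega> of None \<Rightarrow> 0 | Some j \<Rightarrow> h j \<omega>)"
    proof (rule AE_I2)
      fix \<omega>
      show "(\<lambda>N. S N \<omega>) \<longlonglongrightarrow> (case X \<omega> of None \<Rightarrow> 0 | Some j \<Rightarrow> h j \<omega>)"
      proof (cases "X \<omega>")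
        case (Some j)
        then have "eventually (\<lambda>N. S N \<omega> = h j \<omega>) sequentially"
          by (auto simp: S eventually_sequentially intro!: exI[of _ "Suc j"])
        then show ?thesis
          using Some by (simp add: tendsto_eventually)
      qed (simp add: S)
    qed
    show "AE \<omega> in M. norm (S N \<omega>) \<le> 1" for N
      by (rule AE_I2) (auto simp: S bound split: option.split)
  qed simp
  then show ?thesis
    by (simp add: sums_def S_def[abs_def] int)
qed

text \<open>
  \<open>Z\<^sub>n\<close> as a function of the offspring variables alone: its measurability with respect to the first
  \<open>n\<close> generations makes \<open>Z\<^sub>n\<close> independent of generation \<open>n + 1\<close>.
\<close>

fun gw_path :: "(nat \<times> nat \<Rightarrow> nat option) \<Rightarrow> nat \<Rightarrow> nat option" where
  "gw_path x 0 = Some 1"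
| "gw_path x (Suc n) =
    (case gw_path x n of
       None \<Rightarrow> None
     | Some k \<Rightarrow>
         if \<exists>i<k. x (Suc n, i) = None then None
         else Some (\<Sum>i<k. the (x (Suc n, i))))"

lemma gw_path_cong:
  assumes "\<And>m i. 1 \<le> m \<Longrightarrow> m \<le> n \<Longrightarrow> x (m, i) = y (m, i)"
  shows "gw_path x n = gw_path y n"
  using assms by (induction n) (auto split: option.split)

text \<open>The number of summands is random, but all intermediate states lie in countable types.
  Each can therefore be frozen at a fixed value, for which measurability is plain, and
  \<open>measurable_compose_countable\<close> puts the values together.\<close>

lemma measurable_gw_path:
  assumes "{1..n} \<times> UNIV \<subseteq> J"
  shows "(\<lambda>x. gw_path x n) \<in> measurable (PiM J (\<lambda>_. count_space UNIV)) (count_space UNIV)"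
  using assms
proof (induction n)
  case (Suc n)
  have "{1..n} \<times> UNIV \<subseteq> J"
    using Suc.prems by auto
  then have IH [measurable]:
    "(\<lambda>x. gw_path x n) \<in> measurable (PiM J (\<lambda>_. count_space UNIV)) (count_space UNIV)"
    by (rule Suc.IH)
  have comp [measurable]: "(\<lambda>x. x (Suc n, i)) \<in> measurable (PiM J (\<lambda>_. count_space UNIV)) (count_space UNIV)" for i
    by (rule measurable_component_singleton) (use Suc.prems in auto)
  have sum: "(\<lambda>x :: nat \<times> nat \<Rightarrow> nat option. \<Sum>i<k. the (x (Suc n, i))) \<in> measurable (PiM J (\<lambda>_. count_space UNIV)) (count_space UNIV)"
    for k :: nat
  proof (induction k)
    case (Suc k)
    have "(\<lambda>x. m + the (x (Suc n, k))) \<in> measurable (PiM J (\<lambda>_. count_space UNIV)) (count_space UNIV)" for m :: nat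
      by (rule measurable_compose[OF comp]) simp
    from measurable_compose_countable[OF this Suc] show ?case
      by simp
  qed simp
  have [measurable]: "(\<lambda>x :: nat \<times> nat \<Rightarrow> nat option. Some (\<Sum>i<k. the (x (Suc n, i))))
      \<in> measurable (PiM J (\<lambda>_. count_space UNIV)) (count_space UNIV)" for k :: nat
    by (rule measurable_compose[OF sum]) simp
  have "(\<lambda>x :: nat \<times> nat \<Rightarrow> nat option. case z of None \<Rightarrow> None | Some k \<Rightarrow>
        if \<exists>i<k. x (Suc n, i) = None then None else Some (\<Sum>i<k. the (x (Suc n, i))))
      \<in> measurable (PiM J (\<lambda>_. count_space UNIV)) (count_space UNIV)" for z
    by (cases z) simp_all
  from measurable_compose_countable[OF this IH] show ?case
    by simp
qed simp

section \<open>Independence of successive generations\<close>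

context gw_theta_process
begin

lemma random_variable_xi:
  "1 \<le> n \<Longrightarrow> \<xi> n i \<in> measurable M (count_space UNIV)"
  using indep by (auto simp: indep_vars_def2)

text \<open>The restriction to generations \<open>1..n\<close> brings \<open>Z n\<close> into the
  form to which independence of disjoint blocks of the family \<open>\<xi>\<close> applies.\<close>

lemma Z_eq_gw_path:
  assumes "\<omega> \<in> space M"
  shows "Z n \<omega> = gw_path (\<lambda>(m, i)\<in>{1..n} \<times> UNIV. \<xi> m i \<omega>) n"
proof -
  have "Z n \<omega> = gw_path (\<lambda>(m, i). \<xi> m i \<omega>) n"
    by (induction n) (auto simp: Z_0 Z_Suc assms split: option.split)
  also have "\<dots> = gw_path (\<lambda>(m, i)\<in>{1..n} \<times> UNIV. \<xi> m i \<omega>) n"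
    by (rule gw_path_cong) auto
  finally show ?thesis .
qed

lemma random_variable_Z [measurable]: "Z n \<in> measurable M (count_space UNIV)"
proof -
  have "(\<lambda>\<omega>. \<lambda>mi\<in>{1..n} \<times> UNIV. case mi of (m, i) \<Rightarrow> \<xi> m i \<omega>)
      \<in> measurable M (PiM ({1..n} \<times> UNIV) (\<lambda>_. count_space UNIV))"
    by (rule measurable_restrict) (auto intro: random_variable_xi)
  from measurable_compose[OF this measurable_gw_path[OF order_refl]]
  show ?thesis
    by (subst measurable_cong[OF Z_eq_gw_path]) (simp_all add: case_prod_beta')
qed

text \<open>On the event \<open>Z n = Some k\<close> the product has a fixed number of factors, all
  from generation \<open>n + 1\<close> and so independent of that event and of each other; each
  factor has mean \<open>m\<close>. Summing over \<open>k\<close> gives the claim. It serves twice: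
  with powers of \<open>s\<close> for the generating function, and with the indicator of exactly one
  child for the probability of a change.\<close>

lemma expectation_offspring_prod:
  fixes g :: "nat option \<Rightarrow> real"
  assumes g: "\<And>z. 0 \<le> g z" "\<And>z. g z \<le> 1"
    and m: "\<And>i. expectation (\<lambda>\<omega>. g (\<xi> (Suc n) i \<omega>)) = m"
  shows "expectation (\<lambda>\<omega>. case Z n \<omega> of None \<Rightarrow> 0 | Some k \<Rightarrow> \<Prod>i<k. g (\<xi> (Suc n) i \<omega>))
       = expectation (\<lambda>\<omega>. case Z n \<omega> of None \<Rightarrow> 0 | Some k \<Rightarrow> m ^ k)"
proof -
  let ?A = "{1..n} \<times> (UNIV :: nat set)" and ?B = "{Suc n} \<times> (UNIV :: nat set)"
  let ?\<xi> = "\<lambda>(m, i). \<xi> m i"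
  note [measurable] = random_variable_xi[of "Suc n", simplified]
  have gm [measurable]: "(\<lambda>\<omega>. g (\<xi> (Suc n) i \<omega>)) \<in> borel_measurable M" for i
    by measurable
  have int: "integrable M (\<lambda>\<omega>. g (\<xi> (Suc n) i \<omega>))" for i
    by (rule integrable_const_bound[where B = 1]) (auto simp: g)
  have m01: "0 \<le> m" "m \<le> 1"
    using integral_ge_const[OF int[of 0], of 0] integral_le_const[OF int[of 0], of 1] g m[of 0] by auto
  have prod01: "0 \<le> (\<Prod>i<k. g (h i))" "(\<Prod>i<k. g (h i)) \<le> 1" for k :: nat and h :: "nat \<Rightarrow> nat option"
    using g by (auto intro: prod_nonneg prod_le_1)
  have indAB: "indep_var (PiM ?A (\<lambda>_. count_space UNIV)) (\<lambda>\<omega>. restrict (\<lambda>mi. ?\<xi> mi \<omega>) ?A)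
      (PiM ?B (\<lambda>_. count_space UNIV)) (\<lambda>\<omega>. restrict (\<lambda>mi. ?\<xi> mi \<omega>) ?B)"
    by (rule indep_var_restrict[OF indep]) auto
  have each: "expectation (\<lambda>\<omega>. if Z n \<omega> = Some k then \<Prod>i<k. g (\<xi> (Suc n) i \<omega>) else 0)
      = expectation (\<lambda>\<omega>. if Z n \<omega> = Some k then m ^ k else 0)" for k
  proof -
    \<comment> \<open>\<open>u\<close> reads only generations up to \<open>n\<close> and
      \<open>v\<close> only generation \<open>n + 1\<close>, so the two are independent after
      composition with the two restrictions.\<close>
    define u where "u x = (if gw_path x n = Some k then 1 else 0 :: real)" for x
    define v where "v x = (\<Prod>i<k. g (x (Suc n, i)))" for x
    let ?U = "\<lambda>\<omega>. u (restrict (\<lambda>mi. ?\<xi> mi \<omega>) ?A)" and ?V = "\<lambda>\<omega>. v (restrict (\<lambda>mi. ?\<xi> mi \<omega>) ?B)"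
    note [measurable] = measurable_gw_path[OF order_refl, of n]
    have comp [measurable]: "(\<lambda>x. x (Suc n, i)) \<in> measurable (PiM ?B (\<lambda>_. count_space UNIV)) (count_space UNIV)" for i
      by (rule measurable_component_singleton) auto
    have um: "u \<in> borel_measurable (PiM ?A (\<lambda>_. count_space UNIV))"
      unfolding u_def by measurable
    have vm: "v \<in> borel_measurable (PiM ?B (\<lambda>_. count_space UNIV))"
      unfolding v_def by measurable
    have "indep_var borel ?U borel ?V"
      using indep_var_compose[OF indAB um vm] by (simp add: comp_def)
    moreover have U: "?U \<omega> = (if Z n \<omega> = Some k then 1 else 0)" if "\<omega> \<in> space M" for \<omega>
      using that by (simp add: u_def Z_eq_gw_path case_prod_beta')
    have V: "?V \<omega> = (\<Prod>i<k. g (\<xi> (Suc n) i \<omega>))" for \<omega>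
      by (simp add: v_def)
    have iU: "integrable M ?U"
      by (subst Bochner_Integration.integrable_cong[OF refl U])
        (auto intro!: integrable_const_bound[where B = 1])
    have iV: "integrable M ?V"
      unfolding V by (rule integrable_const_bound[where B = 1]) (auto simp: prod01)
    ultimately have "expectation (\<lambda>\<omega>. ?U \<omega> * ?V \<omega>) = expectation ?U * expectation ?V"
      using iU iV by (intro indep_var_lebesgue_integral)
    moreover have "expectation ?V = m ^ k"
    proof (cases "k = 0")
      case False
      have "indep_vars (\<lambda>_. count_space UNIV) ?\<xi> ((\<lambda>i. (Suc n, i)) ` {..<k})"
        by (rule indep_vars_subset[OF indep]) auto
      from indep_vars_compose2[OF this, of "\<lambda>_. g" "\<lambda>_. borel"]
      have iv: "indep_vars (\<lambda>_. borel) (\<lambda>mi \<omega>. g (?\<xi> mi \<omega>)) ((\<lambda>i. (Suc n, i)) ` {..<k})"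
        by simp
      have "expectation (\<lambda>\<omega>. \<Prod>mi\<in>(\<lambda>i. (Suc n, i)) ` {..<k}. g (?\<xi> mi \<omega>))
          = (\<Prod>mi\<in>(\<lambda>i. (Suc n, i)) ` {..<k}. expectation (\<lambda>\<omega>. g (?\<xi> mi \<omega>)))"
        by (rule indep_vars_lebesgue_integral[OF _ iv]) (auto intro: int)
      then show ?thesis
        by (simp add: V prod.reindex inj_on_def m)
    qed (simp add: V prob_space)
    moreover have "expectation (\<lambda>\<omega>. ?U \<omega> * ?V \<omega>)
        = expectation (\<lambda>\<omega>. if Z n \<omega> = Some k then \<Prod>i<k. g (\<xi> (Suc n) i \<omega>) else 0)"
      by (rule Bochner_Integration.integral_cong) (simp_all only: U V, auto)
    moreover have "expectation ?U * m ^ k = expectation (\<lambda>\<omega>. if Z n \<omega> = Some k then m ^ k else 0)"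
      by (subst integral_mult_left_zero[symmetric], rule Bochner_Integration.integral_cong)
        (simp_all only: U, auto)
    ultimately show ?thesis by simp
  qed
  have "(\<lambda>k. expectation (\<lambda>\<omega>. if Z n \<omega> = Some k then \<Prod>i<k. g (\<xi> (Suc n) i \<omega>) else 0)) sums
      expectation (\<lambda>\<omega>. case Z n \<omega> of None \<Rightarrow> 0 | Some k \<Rightarrow> \<Prod>i<k. g (\<xi> (Suc n) i \<omega>))"
    by (rule option_expectation_sums) (auto simp: prod01 intro!: abs_leI order_trans[OF _ prod01(1)])
  moreover have "(\<lambda>k. expectation (\<lambda>\<omega>. if Z n \<omega> = Some k then m ^ k else 0)) sums
      expectation (\<lambda>\<omega>. case Z n \<omega> of None \<Rightarrow> 0 | Some k \<Rightarrow> m ^ k)"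
    by (rule option_expectation_sums) (auto simp: m01 power_le_one)
  ultimately show ?thesis
    unfolding each by (rule sums_unique2)
qed

end


section \<open>Composition and derivative of the explicit generating functions\<close>

text \<open>In the coordinate \<open>(r - s) powr (- \<theta>)\<close> both maps are affine, and the
  parameters compose as those of affine maps do. Positivity of the inner base makes the powers
  \<open>- 1 / \<theta>\<close> and \<open>- \<theta>\<close> cancel.\<close>

lemma gw_f_comp:
  assumes "0 < \<theta>" "0 < a'" "0 \<le> c'" "s < r"
  shows "gw_f \<theta> r a c (gw_f \<theta> r a' c' s) = gw_f \<theta> r (a * a') (c + a * c') s"
proof -
  have "0 < a' * (r - s) powr (- \<theta>) + c'"
    using assms by (intro add_pos_nonneg mult_pos_pos) auto
  then show ?thesis
    using assms(1) by (simp add: gw_f_def powr_powr algebra_simps)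
qed

lemma A_seq_0: "A_seq a 0 = 1"
  and A_seq_Suc: "A_seq a (Suc n) = A_seq a n * a (Suc n)"
  and C_seq_0: "C_seq a c 0 = 0"
  and C_seq_Suc: "C_seq a c (Suc n) = C_seq a c n + A_seq a n * c (Suc n)"
  by (simp_all add: A_seq_def C_seq_def)

text \<open>Applied at \<open>s = 0\<close> for the probability of one child and at
  \<open>s = 1\<close> for the mean. Both points lie strictly below \<open>r\<close>, so the
  two-sided derivative exists there.\<close>

lemma gw_f_has_derivative:
  assumes "0 < \<theta>" "0 \<le> a" "0 \<le> c" "0 < a + c" "s < r"
  shows "(gw_f \<theta> r a c has_real_derivative
    a * (r - s) powr (- \<theta> - 1) * (a * (r - s) powr (- \<theta>) + c) powr (- 1 / \<theta> - 1)) (at s)"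
proof -
  have "0 < a * (r - s) powr (- \<theta>) + c"
    using assms by (cases "a = 0") (auto intro!: add_pos_nonneg)
  with assms show ?thesis
    unfolding gw_f_def[abs_def]
    by (auto intro!: derivative_eq_intros)
qed

section \<open>Law of the generation size: generating function, one-child probability and
  mean\<close>

context gw_theta_process
begin

lemma expectation_offspring:
  assumes "\<And>j. 0 \<le> g j" "\<And>j. g j \<le> 1"
  shows "(\<lambda>j. p (Suc n) j * g j) sums
    expectation (\<lambda>\<omega>. case \<xi> (Suc n) i \<omega> of None \<Rightarrow> 0 | Some j \<Rightarrow> g j)"
proof -
  note [measurable] = random_variable_xi[of "Suc n", simplified]
  have "expectation (\<lambda>\<omega>. if \<xi> (Suc n) i \<omega> = Some j then g j else 0) = p (Suc n) j * g j" for j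
  proof -
    have "expectation (\<lambda>\<omega>. if \<xi> (Suc n) i \<omega> = Some j then g j else 0)
        = expectation (\<lambda>\<omega>. indicator {\<omega> \<in> space M. \<xi> (Suc n) i \<omega> = Some j} \<omega> * g j)"
      by (rule Bochner_Integration.integral_cong) auto
    then show ?thesis
      by (simp add: offspring)
  qed
  moreover have "(\<lambda>j. expectation (\<lambda>\<omega>. if \<xi> (Suc n) i \<omega> = Some j then g j else 0)) sums
      expectation (\<lambda>\<omega>. case \<xi> (Suc n) i \<omega> of None \<Rightarrow> 0 | Some j \<Rightarrow> g j)"
    by (rule option_expectation_sums) (use assms in auto)
  ultimately show ?thesis by simp
qed

lemma expectation_offspring_pgf:
  assumes "0 \<le> s" "s \<le> 1"
  shows "expectation (\<lambda>\<omega>. case \<xi> (Suc n) i \<omega> of None \<Rightarrow> 0 | Some j \<Rightarrow> s ^ j)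
    = gw_f \<theta> r (a (Suc n)) (c (Suc n)) s"
  using expectation_offspring[of "\<lambda>j. s ^ j" n i] pgf[of "Suc n" s] assms
  by (auto intro: sums_unique2 simp: power_le_one)

lemma random_variable_case_option [measurable]:
  fixes g :: "nat \<Rightarrow> real"
  assumes [measurable]: "X \<in> measurable M (count_space UNIV)"
  shows "(\<lambda>\<omega>. case X \<omega> of None \<Rightarrow> 0 | Some k \<Rightarrow> g k) \<in> borel_measurable M"
  by measurable

lemma integrable_case_option:
  fixes g :: "nat \<Rightarrow> real"
  assumes "X \<in> measurable M (count_space UNIV)" "\<And>k. \<bar>g k\<bar> \<le> B" "0 \<le> B"
  shows "integrable M (\<lambda>\<omega>. case X \<omega> of None \<Rightarrow> 0 | Some k \<Rightarrow> g k)"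
  by (rule integrable_const_bound[where B = B])
    (use assms in \<open>auto split: option.split intro: random_variable_case_option\<close>)

text \<open>The value is the expectation of a variable between 0 and 1. This is what allows the
  induction for \<open>pgf_Z\<close> to move from \<open>s\<close> to the value of the next
  generating function at \<open>s\<close>.\<close>

lemma gw_f_in_unit_interval:
  assumes "0 \<le> s" "s \<le> 1"
  shows "gw_f \<theta> r (a (Suc n)) (c (Suc n)) s \<in> {0..1}"
proof -
  let ?X = "\<lambda>\<omega>. case \<xi> (Suc n) 0 \<omega> of None \<Rightarrow> 0 | Some j \<Rightarrow> s ^ j"
  have "integrable M ?X"
    by (rule integrable_case_option[where B = 1])
      (use assms in \<open>auto simp: power_le_one random_variable_xi\<close>)
  moreover have "0 \<le> ?X \<omega>" "?X \<omega> \<le> 1" for \<omega>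
    using assms by (auto split: option.split simp: power_le_one)
  ultimately have "expectation ?X \<in> {0..1}"
    by (auto intro!: integral_ge_const integral_le_const)
  then show ?thesis
    using expectation_offspring_pgf[OF assms] by simp
qed

lemma c_pos: "1 \<le> n \<Longrightarrow> 0 < c n"
proof -
  assume n: "1 \<le> n"
  then have "0 < (1 - a n) * r powr (- \<theta>)"
    using a[of n] r by simp
  with c[OF n] show ?thesis by linarith
qed

lemma A_seq_pos: "0 < A_seq a n"
  unfolding A_seq_def by (rule prod_pos) (use a in auto)

lemma C_seq_nonneg: "0 \<le> C_seq a c n"
  unfolding C_seq_def by (intro sum_nonneg mult_nonneg_nonneg less_imp_le[OF A_seq_pos])
    (use c_pos in \<open>auto intro: less_imp_le\<close>)

lemma decseq_A_seq: "decseq (A_seq a)"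
proof (rule decseq_SucI)
  show "A_seq a (Suc n) \<le> A_seq a n" for n
    using A_seq_pos[of n] a[of "Suc n"] by (simp add: A_seq_Suc mult_left_le)
qed

lemma incseq_C_seq: "incseq (C_seq a c)"
  by (rule incseq_SucI) (use A_seq_pos c_pos in \<open>auto simp: C_seq_Suc less_imp_le\<close>)

text \<open>The bounds on \<open>c\<close> are multiples of \<open>1 - a (Suc n)\<close>, and
  \<open>A_seq a n * (1 - a (Suc n))\<close> is the decrement of \<open>A_seq a\<close>, so the sums
  telescope to \<open>1 - A_seq a n\<close>.\<close>

lemma C_seq_bounds:
  "(1 - A_seq a n) * r powr (- \<theta>) \<le> C_seq a c n \<and> C_seq a c n \<le> (1 - A_seq a n) * (r - 1) powr (- \<theta>)"
proof (induction n)
  case (Suc n)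
  have "A_seq a n * ((1 - a (Suc n)) * r powr (- \<theta>)) \<le> A_seq a n * c (Suc n)"
    "A_seq a n * c (Suc n) \<le> A_seq a n * ((1 - a (Suc n)) * (r - 1) powr (- \<theta>))"
    using A_seq_pos[of n] c[of "Suc n"] by (auto intro!: mult_left_mono)
  then show ?case
    using Suc by (simp add: A_seq_Suc C_seq_Suc algebra_simps)
qed (simp add: A_seq_0 C_seq_0)

text \<open>Averaging over generation \<open>n + 1\<close> replaces \<open>s\<close> by the value of
  its generating function at \<open>s\<close>; hence the induction over arbitrary \<open>s\<close>,
  with \<open>gw_f_comp\<close> merging the parameters.\<close>

lemma pgf_Z:
  assumes "0 \<le> s" "s \<le> 1"
  shows "expectation (\<lambda>\<omega>. case Z n \<omega> of None \<Rightarrow> 0 | Some k \<Rightarrow> s ^ k)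
    = gw_f \<theta> r (A_seq a n) (C_seq a c n) s"
  using assms
proof (induction n arbitrary: s)
  case 0
  have "expectation (\<lambda>\<omega>. case Z 0 \<omega> of None \<Rightarrow> 0 | Some k \<Rightarrow> s ^ k) = expectation (\<lambda>\<omega>. s)"
    by (rule Bochner_Integration.integral_cong) (auto simp: Z_0)
  then show ?case
    using 0 r theta by (simp add: prob_space gw_f_def A_seq_0 C_seq_0 powr_powr)
next
  case (Suc n)
  let ?g = "\<lambda>z. case z of None \<Rightarrow> 0 | Some j \<Rightarrow> s ^ j"
  let ?s = "gw_f \<theta> r (a (Suc n)) (c (Suc n)) s"
  \<comment> \<open>With \<open>None\<close> weighted by 0, a single failing individual annihilates
    the product, so one formula covers both branches of the recursion for \<open>Z\<close>.\<close>
  have prod: "(\<Prod>i<k. ?g (h i)) = (if \<exists>i<k. h i = None then 0 else s ^ (\<Sum>i<k. the (h i)))"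
    for k and h :: "nat \<Rightarrow> nat option"
    by (induction k) (auto simp: less_Suc_eq power_add split: option.split)
  have "expectation (\<lambda>\<omega>. ?g (Z (Suc n) \<omega>))
      = expectation (\<lambda>\<omega>. case Z n \<omega> of None \<Rightarrow> 0 | Some k \<Rightarrow> \<Prod>i<k. ?g (\<xi> (Suc n) i \<omega>))"
    by (rule Bochner_Integration.integral_cong) (auto simp: Z_Suc prod split: option.split)
  also have "\<dots> = expectation (\<lambda>\<omega>. case Z n \<omega> of None \<Rightarrow> 0 | Some k \<Rightarrow> ?s ^ k)"
    by (rule expectation_offspring_prod)
      (use Suc.prems in \<open>auto simp: expectation_offspring_pgf power_le_one split: option.split\<close>)
  also have "\<dots> = gw_f \<theta> r (A_seq a n) (C_seq a c n) ?s"
    using gw_f_in_unit_interval[OF Suc.prems, of n] by (intro Suc.IH) auto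
  also have "\<dots> = gw_f \<theta> r (A_seq a (Suc n)) (C_seq a c (Suc n)) s"
    using theta r a[of "Suc n"] c_pos[of "Suc n"] Suc.prems
    by (simp add: gw_f_comp A_seq_Suc C_seq_Suc)
  finally show ?case .
qed

text \<open>The coefficient of the first power is the derivative at 0, computed once from the power
  series and once from the closed form.\<close>

lemma prob_offspring_one:
  "p (Suc n) 1 = a (Suc n) * r powr (- \<theta> - 1) *
    (a (Suc n) * r powr (- \<theta>) + c (Suc n)) powr (- 1 / \<theta> - 1)"
proof -
  let ?f = "gw_f \<theta> r (a (Suc n)) (c (Suc n))"
  let ?F = "\<lambda>s. \<Sum>j. p (Suc n) j * s ^ j"
  have sums: "(\<lambda>j. p (Suc n) j * s ^ j) sums ?f s" if "0 \<le> s" "s \<le> 1" for s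
    using pgf[of "Suc n" s] that by simp
  have F: "?F s = ?f s" if "0 \<le> s" "s \<le> 1" for s
    using sums_unique[OF sums[OF that]] by simp
  have "(?F has_real_derivative (\<Sum>j. diffs (p (Suc n)) j * 0 ^ j)) (at 0)"
    by (rule termdiffs_strong[where K = 1]) (use sums_summable[OF sums[of 1]] in simp_all)
  moreover have "(\<Sum>j. diffs (p (Suc n)) j * 0 ^ j) = p (Suc n) 1"
    by (subst powser_zero) (simp add: diffs_def)
  ultimately have "(?F has_real_derivative p (Suc n) 1) (at 0 within {0<..})"
    by (metis has_field_derivative_at_within)
  then have 1: "((\<lambda>s. (?F s - ?F 0) / (s - 0)) \<longlongrightarrow> p (Suc n) 1) (at_right 0)"
    by (simp only: has_field_derivative_iff)
  have "(?f has_real_derivative a (Suc n) * (r - 0) powr (- \<theta> - 1) *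
      (a (Suc n) * (r - 0) powr (- \<theta>) + c (Suc n)) powr (- 1 / \<theta> - 1)) (at 0 within {0<..})"
    by (rule has_field_derivative_at_within, rule gw_f_has_derivative)
      (use theta r a[of "Suc n"] c_pos[of "Suc n"] in \<open>simp_all add: less_imp_le add_pos_pos\<close>)
  then have 2: "((\<lambda>s. (?f s - ?f 0) / (s - 0)) \<longlongrightarrow> a (Suc n) * (r - 0) powr (- \<theta> - 1) *
      (a (Suc n) * (r - 0) powr (- \<theta>) + c (Suc n)) powr (- 1 / \<theta> - 1)) (at_right 0)"
    by (simp only: has_field_derivative_iff)
  \<comment> \<open>The series is known to equal the closed form only on the unit interval, so the
    two derivatives are compared through right-hand difference quotients.\<close>
  have "eventually (\<lambda>s. (?F s - ?F 0) / (s - 0) = (?f s - ?f 0) / (s - 0)) (at_right 0)"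
    using eventually_at_right_real[OF zero_less_one]
  proof (rule eventually_mono)
    fix s :: real
    assume "s \<in> {0<..<1}"
    then show "(?F s - ?F 0) / (s - 0) = (?f s - ?f 0) / (s - 0)"
      using F[of s] F[of 0] by simp
  qed
  from 1 tendsto_cong[OF this] have "((\<lambda>s. (?f s - ?f 0) / (s - 0)) \<longlongrightarrow> p (Suc n) 1) (at_right 0)"
    by (simp only:)
  from tendsto_unique[OF _ this 2] show ?thesis
    by (simp only: diff_zero trivial_limit_at_right_real not_False_eq_True)
qed

text \<open>The geometric sums with \<open>k\<close> terms and ratio \<open>s\<close> increase to
  \<open>k\<close> as \<open>s\<close> increases to 1, and their expectations are difference
  quotients of the generating function. Monotone convergence yields integrability together with the
  value, the derivative at 1.\<close>

lemma expectation_Z: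
  "integrable M (\<lambda>\<omega>. case Z n \<omega> of None \<Rightarrow> 0 | Some k \<Rightarrow> real k)"
  "expectation (\<lambda>\<omega>. case Z n \<omega> of None \<Rightarrow> 0 | Some k \<Rightarrow> real k)
    = A_seq a n * (r - 1) powr (- \<theta> - 1) * (A_seq a n * (r - 1) powr (- \<theta>) + C_seq a c n) powr (- 1 / \<theta> - 1)"
    (is "_ = ?D")
proof -
  define s where "s i = 1 - inverse (real (Suc i))" for i
  have s01: "0 \<le> s i" "s i < 1" for i
    by (auto simp: s_def field_simps)
  have s_lim: "s \<longlonglongrightarrow> 1"
    unfolding s_def[abs_def] using tendsto_diff[OF tendsto_const LIMSEQ_inverse_real_of_nat] by auto
  have s_mono: "s i \<le> s j" if "i \<le> j" for i j
    using that by (auto simp: s_def field_simps)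
  define F where "F = gw_f \<theta> r (A_seq a n) (C_seq a c n)"
  let ?g = "\<lambda>i \<omega>. case Z n \<omega> of None \<Rightarrow> 0 | Some k \<Rightarrow> (\<Sum>m<k. s i ^ m)"
  \<comment> \<open>The term \<open>1 ^ k\<close> is kept unevaluated so that \<open>pgf_Z\<close>
    applies at 1: its expectation is \<open>F 1\<close>, which may be less than 1 because of the
    defect.\<close>
  have eq: "?g i \<omega> = ((case Z n \<omega> of None \<Rightarrow> 0 | Some k \<Rightarrow> 1 ^ k) - (case Z n \<omega> of None \<Rightarrow> 0 | Some k \<Rightarrow> s i ^ k)) / (1 - s i)"
    for i \<omega>
    using s01[of i] by (auto split: option.split simp: sum_gp_strict)
  have int: "integrable M (\<lambda>\<omega>. case Z n \<omega> of None \<Rightarrow> 0 | Some k \<Rightarrow> t ^ k)"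
    if "0 \<le> t" "t \<le> 1" for t :: real
    by (rule integrable_case_option[where B = 1]) (use that in \<open>auto simp: power_le_one\<close>)
  have int_g: "integrable M (?g i)" for i
    unfolding eq using int[of 1] int[of "s i"] s01[of i] by auto
  have E_g: "expectation (?g i) = (F 1 - F (s i)) / (1 - s i)" for i
  proof -
    have "expectation (?g i) = (expectation (\<lambda>\<omega>. case Z n \<omega> of None \<Rightarrow> 0 | Some k \<Rightarrow> 1 ^ k)
        - expectation (\<lambda>\<omega>. case Z n \<omega> of None \<Rightarrow> 0 | Some k \<Rightarrow> s i ^ k)) / (1 - s i)"
      unfolding eq using int[of 1] int[of "s i"] s01[of i]
      by (simp add: Bochner_Integration.integral_diff)
    also have "\<dots> = (F 1 - F (s i)) / (1 - s i)"
      using s01[of i] by (subst (1 2) pgf_Z) (auto simp: F_def)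
    finally show ?thesis .
  qed
  have "(F has_real_derivative ?D) (at 1)"
    unfolding F_def using theta r A_seq_pos C_seq_nonneg
    by (intro gw_f_has_derivative) (auto simp: less_imp_le add_pos_nonneg)
  then have "((\<lambda>y. (F y - F 1) / (y - 1)) \<longlongrightarrow> ?D) (at 1)"
    by (simp add: has_field_derivative_iff)
  moreover have "filterlim s (at 1) sequentially"
    using s_lim s01 by (auto simp: filterlim_at less_imp_neq intro!: always_eventually)
  ultimately have "(\<lambda>i. (F (s i) - F 1) / (s i - 1)) \<longlonglongrightarrow> ?D"
    by (rule filterlim_compose)
  moreover have "(F (s i) - F 1) / (s i - 1) = (F 1 - F (s i)) / (1 - s i)" for i
    by (metis minus_diff_eq minus_divide_divide)
  ultimately have lim: "(\<lambda>i. expectation (?g i)) \<longlonglongrightarrow> ?D"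
    by (simp add: E_g)
  have mono: "AE \<omega> in M. mono (\<lambda>i. ?g i \<omega>)"
  proof (intro AE_I2 monoI)
    show "?g i \<omega> \<le> ?g j \<omega>" if "i \<le> j" for i j \<omega>
      using s_mono[OF that] s01[of i] by (cases "Z n \<omega>") (auto intro!: sum_mono power_mono)
  qed
  have conv: "AE \<omega> in M. (\<lambda>i. ?g i \<omega>) \<longlonglongrightarrow> (case Z n \<omega> of None \<Rightarrow> 0 | Some k \<Rightarrow> real k)"
  proof (rule AE_I2)
    fix \<omega>
    have "(\<lambda>i. \<Sum>m<k. s i ^ m) \<longlonglongrightarrow> (\<Sum>m<k. 1 ^ m)" for k
      by (intro tendsto_intros s_lim)
    then show "(\<lambda>i. ?g i \<omega>) \<longlonglongrightarrow> (case Z n \<omega> of None \<Rightarrow> 0 | Some k \<Rightarrow> real k)"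
      by (cases "Z n \<omega>") auto
  qed
  note * = int_g mono conv lim random_variable_case_option[OF random_variable_Z]
  show "integrable M (\<lambda>\<omega>. case Z n \<omega> of None \<Rightarrow> 0 | Some k \<Rightarrow> real k)"
    by (rule integrable_monotone_convergence[OF *])
  show "expectation (\<lambda>\<omega>. case Z n \<omega> of None \<Rightarrow> 0 | Some k \<Rightarrow> real k) = ?D"
    by (rule integral_monotone_convergence[OF *])
qed

end

subsection \<open>Limits of the generating functions and absorption times\<close>


text \<open>Pulling \<open>R powr (- \<theta>)\<close> out of the base produces
  \<open>R powr (\<theta> + 1)\<close>, which cancels the prefactor. Used with \<open>R = r\<close>
  for the one-child probability and with \<open>R = r - 1\<close> for the limit of the
  means.\<close>

lemma powr_rescale:
  fixes R Y \<theta> :: real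
  assumes "0 < R" "0 \<le> Y" "0 < \<theta>"
  shows "R powr (- \<theta> - 1) * (R powr (- \<theta>) * Y) powr (- 1 / \<theta> - 1) = Y powr (- 1 / \<theta> - 1)"
proof -
  have "- \<theta> * (- 1 / \<theta> - 1) = \<theta> + 1"
    using assms(3) by (simp add: field_simps)
  then have "(R powr (- \<theta>) * Y) powr (- 1 / \<theta> - 1) = R powr (\<theta> + 1) * Y powr (- 1 / \<theta> - 1)"
    using assms by (simp add: powr_mult powr_powr)
  moreover have "R powr (- \<theta> - 1) * R powr (\<theta> + 1) = 1"
    using assms by (simp flip: powr_add)
  ultimately show ?thesis
    by (simp add: mult.assoc[symmetric])
qed

lemma gw_f_tendsto:
  assumes "\<alpha> \<longlonglongrightarrow> A" "\<gamma> \<longlonglongrightarrow> C" "0 < A * (r - s) powr (- \<theta>) + C"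
  shows "(\<lambda>n. gw_f \<theta> r (\<alpha> n) (\<gamma> n) s) \<longlonglongrightarrow> gw_f \<theta> r A C s"
  unfolding gw_f_def by (intro tendsto_intros assms) (use assms(3) in auto)

text \<open>The mean value theorem for the power \<open>- 1 / \<theta>\<close> gives the increment
  as a multiple of \<open>\<alpha> n\<close> times the derivative at an intermediate point. Both
  endpoints, and hence that point, tend to \<open>C\<close>.\<close>

lemma gw_f_difference_quotient_tendsto:
  fixes \<alpha> \<gamma> :: "nat \<Rightarrow> real"
  assumes "0 < \<theta>" "t \<le> s" "s < r"
    and \<alpha>: "\<alpha> \<longlonglongrightarrow> 0" "\<And>n. 0 < \<alpha> n"
    and \<gamma>: "\<gamma> \<longlonglongrightarrow> C" "\<And>n. 0 \<le> \<gamma> n" "0 < C"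
  shows "(\<lambda>n. inverse (\<alpha> n) * (gw_f \<theta> r (\<alpha> n) (\<gamma> n) s - gw_f \<theta> r (\<alpha> n) (\<gamma> n) t))
    \<longlonglongrightarrow> ((r - s) powr (- \<theta>) - (r - t) powr (- \<theta>)) * inverse \<theta> * C powr (- 1 / \<theta> - 1)"
proof (cases "s = t")
  \<comment> \<open>The mean value theorem requires a nondegenerate interval; for
    \<open>s = t\<close> both sides vanish.\<close>
  case False
  define x where "x = (r - s) powr (- \<theta>)"
  define y where "y = (r - t) powr (- \<theta>)"
  have "t < s" using False assms by simp
  then have y: "0 < y" "y < x"
    using assms powr_less_mono2_neg[of "- \<theta>" "r - s" "r - t"] by (auto simp: x_def y_def)
  have "\<exists>z. \<alpha> n * y + \<gamma> n < z \<and> z < \<alpha> n * x + \<gamma> n \<and>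
      (\<alpha> n * x + \<gamma> n) powr (- 1 / \<theta>) - (\<alpha> n * y + \<gamma> n) powr (- 1 / \<theta>)
      = (\<alpha> n * x + \<gamma> n - (\<alpha> n * y + \<gamma> n)) * ((- 1 / \<theta>) * z powr (- 1 / \<theta> - 1))" for n
  proof (rule MVT2)
    show "\<alpha> n * y + \<gamma> n < \<alpha> n * x + \<gamma> n"
      using \<alpha>(2)[of n] y by simp
    fix z
    assume "\<alpha> n * y + \<gamma> n \<le> z"
    moreover have "0 < \<alpha> n * y + \<gamma> n"
      using \<alpha>(2)[of n] \<gamma>(2)[of n] y by (simp add: add_pos_nonneg)
    ultimately have "0 < z" by simp
    then show "((\<lambda>u. u powr (- 1 / \<theta>)) has_real_derivative - 1 / \<theta> * z powr (- 1 / \<theta> - 1)) (at z)"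
      by (rule has_real_derivative_powr)
  qed
  then obtain z where z: "\<And>n. \<alpha> n * y + \<gamma> n < z n" "\<And>n. z n < \<alpha> n * x + \<gamma> n"
    and mvt: "\<And>n. (\<alpha> n * x + \<gamma> n) powr (- 1 / \<theta>) - (\<alpha> n * y + \<gamma> n) powr (- 1 / \<theta>)
      = (\<alpha> n * x + \<gamma> n - (\<alpha> n * y + \<gamma> n)) * ((- 1 / \<theta>) * z n powr (- 1 / \<theta> - 1))"
    by metis
  have lim: "(\<lambda>n. \<alpha> n * w + \<gamma> n) \<longlonglongrightarrow> C" for w
    using tendsto_add[OF tendsto_mult_left_zero[OF \<alpha>(1), of w] \<gamma>(1)] by simp
  have "z \<longlonglongrightarrow> C"
    by (rule tendsto_sandwich[OF _ _ lim[of y] lim[of x]])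
      (use z in \<open>auto intro!: always_eventually less_imp_le\<close>)
  then have "(\<lambda>n. (x - y) * inverse \<theta> * z n powr (- 1 / \<theta> - 1)) \<longlonglongrightarrow> (x - y) * inverse \<theta> * C powr (- 1 / \<theta> - 1)"
    by (intro tendsto_intros) (use \<gamma>(3) in auto)
  moreover have "inverse (\<alpha> n) * (gw_f \<theta> r (\<alpha> n) (\<gamma> n) s - gw_f \<theta> r (\<alpha> n) (\<gamma> n) t)
      = (x - y) * inverse \<theta> * z n powr (- 1 / \<theta> - 1)" for n
  proof -
    have "gw_f \<theta> r (\<alpha> n) (\<gamma> n) s - gw_f \<theta> r (\<alpha> n) (\<gamma> n) t
        = - ((\<alpha> n * x + \<gamma> n) powr (- 1 / \<theta>) - (\<alpha> n * y + \<gamma> n) powr (- 1 / \<theta>))"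
      by (simp add: gw_f_def x_def y_def)
    also have "\<dots> = \<alpha> n * ((x - y) * inverse \<theta> * z n powr (- 1 / \<theta> - 1))"
      unfolding mvt by (simp add: field_simps)
    finally show ?thesis
      using \<alpha>(2)[of n] by simp
  qed
  ultimately show ?thesis
    by (simp add: x_def y_def)
qed simp

section \<open>Absorption times expressed through the state at a fixed time\<close>

lemma hit_time_less_infinity_iff: "hit_time Z x \<omega> < \<infinity> \<longleftrightarrow> (\<exists>n. Z n \<omega> = x)"
  unfolding hit_time_def INF_less_iff by simp

lemma less_hit_time_iff: "enat n < hit_time Z x \<omega> \<longleftrightarrow> (\<forall>m\<le>n. Z m \<omega> \<noteq> x)"
  by (simp add: hit_time_def le_INF_iff flip: Suc_ile_eq) (metis not_less_eq_eq)

lemma (in prob_space) exp_on_eq_expectation: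
  "exp_on M X E = expectation (\<lambda>\<omega>. if E \<omega> then X \<omega> else 0)"
  unfolding exp_on_def set_lebesgue_integral_def
  by (rule Bochner_Integration.integral_cong) auto

context gw_theta_process
begin

text \<open>From state 0 no individual can fail and the empty sum is 0. Absorption lets the events
  \<open>tau Z \<omega> > enat n\<close> and \<open>tau_Delta Z \<omega> > enat n\<close> be read
  off from \<open>Z n\<close> alone.\<close>

lemma Z_absorbing:
  assumes "\<omega> \<in> space M" "Z n \<omega> \<in> {None, Some 0}" "n \<le> m"
  shows "Z m \<omega> = Z n \<omega>"
  using assms(3) by (induction m rule: dec_induct) (use assms(1,2) in \<open>auto simp: Z_Suc\<close>)

lemma less_tau_Delta_iff:
  "\<omega> \<in> space M \<Longrightarrow> enat n < tau_Delta Z \<omega> \<longleftrightarrow> Z n \<omega> \<noteq> None"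
  unfolding tau_Delta_def less_hit_time_iff using Z_absorbing by (metis insertCI order_refl)

lemma less_tau_iff:
  "\<omega> \<in> space M \<Longrightarrow> enat n < tau Z \<omega> \<longleftrightarrow> Z n \<omega> \<notin> {None, Some 0}"
  unfolding tau_def tau_0_def tau_Delta_def min_less_iff_conj less_hit_time_iff
  using Z_absorbing by (metis insertCI insertE order_refl singletonD)

lemma integrable_power_Z:
  fixes s :: real
  assumes "0 \<le> s" "s \<le> 1"
  shows "integrable M (\<lambda>\<omega>. case Z n \<omega> of None \<Rightarrow> 0 | Some k \<Rightarrow> s ^ k)"
  by (rule integrable_case_option[where B = 1]) (use assms in \<open>auto simp: power_le_one\<close>)

text \<open>Since \<open>0 ^ k\<close> is 1 exactly for \<open>k = 0\<close>, subtracting the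
  generating function at 0 removes the contribution of the state 0 and nothing else.\<close>

lemma pgf_Z_alive:
  assumes "0 \<le> s" "s \<le> 1"
  shows "expectation (\<lambda>\<omega>. if enat n < tau Z \<omega> then s ^ the (Z n \<omega>) else 0)
    = gw_f \<theta> r (A_seq a n) (C_seq a c n) s - gw_f \<theta> r (A_seq a n) (C_seq a c n) 0"
proof -
  have "expectation (\<lambda>\<omega>. if enat n < tau Z \<omega> then s ^ the (Z n \<omega>) else 0)
      = expectation (\<lambda>\<omega>. (case Z n \<omega> of None \<Rightarrow> 0 | Some k \<Rightarrow> s ^ k) - (case Z n \<omega> of None \<Rightarrow> 0 | Some k \<Rightarrow> 0 ^ k))"
    by (rule Bochner_Integration.integral_cong) (auto simp: less_tau_iff split: option.split)
  also have "\<dots> = expectation (\<lambda>\<omega>. case Z n \<omega> of None \<Rightarrow> 0 | Some k \<Rightarrow> s ^ k)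
      - expectation (\<lambda>\<omega>. case Z n \<omega> of None \<Rightarrow> 0 | Some k \<Rightarrow> 0 ^ k)"
    by (rule Bochner_Integration.integral_diff) (use assms in \<open>auto intro: integrable_power_Z\<close>)
  finally show ?thesis
    using assms by (simp only: pgf_Z order_refl zero_le_one)
qed

lemma prob_eq_expectation:
  "Measurable.pred M P \<Longrightarrow> prob {\<omega> \<in> space M. P \<omega>} = expectation (\<lambda>\<omega>. if P \<omega> then 1 else 0)"
  by (subst Bochner_Integration.integral_cong[OF refl, of _ _ "indicator {\<omega> \<in> space M. P \<omega>}"]) auto

lemma prob_Z_eq_0: "prob {\<omega> \<in> space M. Z n \<omega> = Some 0} = gw_f \<theta> r (A_seq a n) (C_seq a c n) 0"
  by (subst pgf_Z[symmetric], simp, simp, subst prob_eq_expectation, measurable)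
    (rule Bochner_Integration.integral_cong, auto split: option.split)

lemma prob_Z_eq_None: "prob {\<omega> \<in> space M. Z n \<omega> = None} = 1 - gw_f \<theta> r (A_seq a n) (C_seq a c n) 1"
proof -
  have "prob {\<omega> \<in> space M. Z n \<omega> \<noteq> None} = gw_f \<theta> r (A_seq a n) (C_seq a c n) 1"
    by (subst pgf_Z[symmetric], simp, simp, subst prob_eq_expectation, measurable)
      (rule Bochner_Integration.integral_cong, auto split: option.split)
  then show ?thesis
    using prob_neg[of "\<lambda>\<omega>. Z n \<omega> \<noteq> None"] by simp
qed

lemma prob_tau_greater:
  "prob {\<omega> \<in> space M. enat n < tau Z \<omega>}
    = gw_f \<theta> r (A_seq a n) (C_seq a c n) 1 - gw_f \<theta> r (A_seq a n) (C_seq a c n) 0"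
proof -
  have "{\<omega> \<in> space M. enat n < tau Z \<omega>} = {\<omega> \<in> space M. Z n \<omega> \<notin> {None, Some 0}}"
    using less_tau_iff by blast
  then have "Measurable.pred M (\<lambda>\<omega>. enat n < tau Z \<omega>)"
    unfolding pred_def by simp
  from prob_eq_expectation[OF this] show ?thesis
    using pgf_Z_alive[of 1 n] by (simp cong: if_cong)
qed

text \<open>
  Generation \<open>n + 1\<close> can differ in size from generation \<open>n\<close> only if some individual does not have
  exactly one child, and \<open>1 - q\<^sup>k \<le> k (1 - q)\<close>.
\<close>

lemma prob_Z_change_le:
  "prob {\<omega> \<in> space M. Z (Suc n) \<omega> \<noteq> Z n \<omega>}
    \<le> (1 - p (Suc n) 1) * expectation (\<lambda>\<omega>. case Z n \<omega> of None \<Rightarrow> 0 | Some k \<Rightarrow> real k)"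
proof -
  let ?q = "p (Suc n) 1"
  let ?g = "\<lambda>z :: nat option. if z = Some 1 then 1 else 0 :: real"
  note [measurable] = random_variable_xi[of "Suc n", simplified]
  have q: "expectation (\<lambda>\<omega>. ?g (\<xi> (Suc n) i \<omega>)) = ?q" for i
    by (subst prob_eq_expectation[symmetric]) (auto simp: offspring)
  have "?q = prob {\<omega> \<in> space M. \<xi> (Suc n) 0 \<omega> = Some 1}"
    using offspring[of "Suc n" 0 1] by simp
  then have q01: "0 \<le> ?q" "?q \<le> 1"
    by simp_all
  \<comment> \<open>The product is the indicator that everybody has exactly one child, which
    excludes a change; if \<open>Z n\<close> is \<open>None\<close> both sides are 0.\<close>
  have ch: "(case Z n \<omega> of None \<Rightarrow> 0 | Some k \<Rightarrow> \<Prod>i<k. ?g (\<xi> (Suc n) i \<omega>)) + (if Z (Suc n) \<omega> \<noteq> Z n \<omega> then 1 else 0)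
      \<le> (case Z n \<omega> of None \<Rightarrow> 0 | Some k \<Rightarrow> 1)" if "\<omega> \<in> space M" for \<omega>
  proof (cases "Z n \<omega>")
    case (Some k)
    show ?thesis
    proof (cases "\<forall>i<k. \<xi> (Suc n) i \<omega> = Some 1")
      case True
      then show ?thesis
        using that Some by (auto simp: Z_Suc)
    next
      case False
      then have zero: "(\<Prod>i<k. ?g (\<xi> (Suc n) i \<omega>)) = 0"
        by (intro prod_zero) auto
      show ?thesis
        unfolding Some option.case zero by simp
    qed
  qed (simp add: Z_Suc that)
  have meas: "(\<lambda>\<omega>. case Z n \<omega> of None \<Rightarrow> 0 | Some k \<Rightarrow> \<Prod>i<k. ?g (\<xi> (Suc n) i \<omega>)) \<in> borel_measurable M"
  proof (rule measurable_compose_countable[OF _ random_variable_Z])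
    show "(\<lambda>\<omega>. case z of None \<Rightarrow> 0 | Some k \<Rightarrow> \<Prod>i<k. ?g (\<xi> (Suc n) i \<omega>)) \<in> borel_measurable M" for z
      by (cases z) simp_all
  qed
  have prod_bound: "\<bar>\<Prod>i<k. ?g (\<xi> (Suc n) i \<omega>)\<bar> \<le> 1" for k \<omega>
    unfolding abs_prod by (rule prod_le_1) auto
  have int: "integrable M (\<lambda>\<omega>. case Z n \<omega> of None \<Rightarrow> 0 | Some k \<Rightarrow> \<Prod>i<k. ?g (\<xi> (Suc n) i \<omega>))"
  proof (rule integrable_const_bound[where B = 1, OF _ meas], rule AE_I2)
    show "norm (case Z n \<omega> of None \<Rightarrow> 0 | Some k \<Rightarrow> \<Prod>i<k. ?g (\<xi> (Suc n) i \<omega>)) \<le> 1" for \<omega>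
      using prod_bound by (cases "Z n \<omega>") (simp_all only: option.case real_norm_def abs_zero zero_le_one)
  qed
  have int': "integrable M (\<lambda>\<omega>. if Z (Suc n) \<omega> \<noteq> Z n \<omega> then 1 else 0 :: real)"
    by (rule integrable_const_bound[where B = 1]) auto
  have int1: "integrable M (\<lambda>\<omega>. case Z n \<omega> of None \<Rightarrow> 0 | Some k \<Rightarrow> (1 :: real))"
    using integrable_power_Z[of 1 n] unfolding power_one by simp
  \<comment> \<open>Independence turns the product into \<open>?q ^ k\<close>; this expectation
    reappears on the right after Bernoulli's inequality and cancels.\<close>
  have "expectation (\<lambda>\<omega>. case Z n \<omega> of None \<Rightarrow> 0 | Some k \<Rightarrow> ?q ^ k) + prob {\<omega> \<in> space M. Z (Suc n) \<omega> \<noteq> Z n \<omega>}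
      = expectation (\<lambda>\<omega>. (case Z n \<omega> of None \<Rightarrow> 0 | Some k \<Rightarrow> \<Prod>i<k. ?g (\<xi> (Suc n) i \<omega>)) + (if Z (Suc n) \<omega> \<noteq> Z n \<omega> then 1 else 0))"
    using expectation_offspring_prod[of ?g n ?q] q int int'
    by (subst prob_eq_expectation) auto
  also have "\<dots> \<le> expectation (\<lambda>\<omega>. case Z n \<omega> of None \<Rightarrow> 0 | Some k \<Rightarrow> 1)"
    using int int' ch int1
    by (intro integral_mono) auto
  also have "\<dots> \<le> expectation (\<lambda>\<omega>. (case Z n \<omega> of None \<Rightarrow> 0 | Some k \<Rightarrow> ?q ^ k) +
      (1 - ?q) * (case Z n \<omega> of None \<Rightarrow> 0 | Some k \<Rightarrow> real k))"
  proof (rule integral_mono)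
    fix \<omega>
    show "(case Z n \<omega> of None \<Rightarrow> 0 | Some k \<Rightarrow> 1) \<le> (case Z n \<omega> of None \<Rightarrow> 0 | Some k \<Rightarrow> ?q ^ k) +
      (1 - ?q) * (case Z n \<omega> of None \<Rightarrow> 0 | Some k \<Rightarrow> real k)"
      using Bernoulli_inequality[of "?q - 1"] q01
      by (auto simp: algebra_simps split: option.split)
  qed (use int1 integrable_power_Z[OF q01] expectation_Z(1) in auto)
  also have "\<dots> = expectation (\<lambda>\<omega>. case Z n \<omega> of None \<Rightarrow> 0 | Some k \<Rightarrow> ?q ^ k) +
      (1 - ?q) * expectation (\<lambda>\<omega>. case Z n \<omega> of None \<Rightarrow> 0 | Some k \<Rightarrow> real k)"
    using integrable_power_Z[OF q01] expectation_Z(1) by simp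
  finally show ?thesis by simp
qed

text \<open>With \<open>Y\<close> the base normalised by \<open>r powr \<theta>\<close>, the
  one-child probability is \<open>a (Suc n) * Y powr (- \<beta>)\<close>. It is bounded below
  through \<open>Y powr (- \<beta>) \<ge> 1 - \<beta> * ln Y\<close> and
  \<open>ln Y \<le> Y - 1\<close>, where \<open>Y - 1\<close> is at most a multiple of
  \<open>1 - a (Suc n)\<close>.\<close>

lemma one_minus_prob_offspring_one_le:
  "1 - p (Suc n) 1 \<le> (1 + (1 / \<theta> + 1) * ((r - 1) powr (- \<theta>) * r powr \<theta> - 1)) * (1 - a (Suc n))"
proof -
  let ?a = "a (Suc n)" and ?c = "c (Suc n)"
  define \<beta> where "\<beta> = 1 / \<theta> + 1"
  \<comment> \<open>The upper bound on \<open>c\<close> makes \<open>\<kappa>\<close> a bound for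
    the ratio of \<open>Y - 1\<close> to \<open>1 - a (Suc n)\<close>.\<close>
  define \<kappa> where "\<kappa> = (r - 1) powr (- \<theta>) * r powr \<theta> - 1"
  define Y where "Y = ?a + ?c * r powr \<theta>"
  have \<beta>: "0 < \<beta>" "- 1 / \<theta> - 1 = - \<beta>"
    using theta by (auto simp: \<beta>_def add_pos_pos)
  have a01: "0 < ?a" "?a < 1" using a[of "Suc n"] by auto
  have Y0: "0 < Y"
    unfolding Y_def using a01 c_pos[of "Suc n"] by (simp add: add_pos_nonneg)
  have "?c * r powr \<theta> \<le> ((1 - ?a) * (r - 1) powr (- \<theta>)) * r powr \<theta>"
    using c[of "Suc n"] by (intro mult_right_mono) auto
  then have Y1: "Y - 1 \<le> (1 - ?a) * \<kappa>"
    by (simp add: Y_def \<kappa>_def algebra_simps)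
  have inv: "r powr (- \<theta>) * r powr \<theta> = 1"
    using r by (simp flip: powr_add)
  have "r powr (- \<theta>) * Y = ?a * r powr (- \<theta>) + ?c"
    using inv by (simp add: Y_def algebra_simps)
  then have "p (Suc n) 1 = ?a * (r powr (- \<theta> - 1) * (r powr (- \<theta>) * Y) powr (- 1 / \<theta> - 1))"
    by (simp only: prob_offspring_one mult.assoc)
  also have "\<dots> = ?a * Y powr (- \<beta>)"
    using powr_rescale[of r Y \<theta>] r Y0 theta by (simp add: \<beta>_def)
  finally have p1: "p (Suc n) 1 = ?a * Y powr (- \<beta>)" .
  have "(r - 1) powr \<theta> \<le> r powr \<theta>"
    using r theta by (intro powr_mono2) auto
  then have \<kappa>: "0 \<le> \<kappa>"
    using r by (simp add: \<kappa>_def powr_minus field_simps)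
  have "1 - \<beta> * ((1 - ?a) * \<kappa>) \<le> 1 - \<beta> * ln Y"
    using Y1 ln_le_minus_one[OF Y0] \<beta>(1) by (intro diff_left_mono mult_left_mono) auto
  also have "\<dots> \<le> exp (- \<beta> * ln Y)"
    using exp_ge_add_one_self[of "- \<beta> * ln Y"] by linarith
  also have "\<dots> = Y powr (- \<beta>)"
    using Y0 by (simp add: powr_def)
  finally have "?a * (1 - \<beta> * ((1 - ?a) * \<kappa>)) \<le> p (Suc n) 1"
    unfolding p1 using a01 by (intro mult_left_mono) auto
  moreover have "?a * (\<beta> * ((1 - ?a) * \<kappa>)) \<le> \<beta> * ((1 - ?a) * \<kappa>)"
    using a01 \<kappa> \<beta>(1) by (intro mult_left_le_one_le mult_nonneg_nonneg) auto
  ultimately have "1 - p (Suc n) 1 \<le> (1 + \<beta> * \<kappa>) * (1 - ?a)"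
    by (simp add: algebra_simps)
  then show ?thesis
    by (simp only: \<beta>_def \<kappa>_def)
qed

end

subsection \<open>Absorption probabilities and almost sure convergence\<close>


context gw_theta_process
begin

lemma A_seq_limit:
  obtains A where "A_seq a \<longlonglongrightarrow> A" "0 \<le> A" "A < 1"
proof -
  obtain A where A: "A_seq a \<longlonglongrightarrow> A" "\<And>n. A \<le> A_seq a n"
    using decseq_convergent[OF decseq_A_seq, of 0] A_seq_pos by (metis less_imp_le)
  have "A_seq a 1 < 1"
    using a[of 1] by (simp add: A_seq_def)
  with A(2)[of 1] have "A < 1" by linarith
  moreover have "0 \<le> A"
    using A(1) by (rule LIMSEQ_le_const) (use A_seq_pos in \<open>auto intro: less_imp_le\<close>)
  ultimately show ?thesis using that A by blast
qed

lemma C_seq_limit: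
  assumes A: "A_seq a \<longlonglongrightarrow> A"
  obtains C where "C_seq a c \<longlonglongrightarrow> C" "(1 - A) * r powr (- \<theta>) \<le> C" "C \<le> (1 - A) * (r - 1) powr (- \<theta>)"
proof -
  have "C_seq a c n \<le> 1 * (r - 1) powr (- \<theta>)" for n
    using C_seq_bounds[of n] A_seq_pos[of n]
    by (elim conjE order_trans) (intro mult_right_mono, auto)
  then obtain C where C: "C_seq a c \<longlonglongrightarrow> C"
    using incseq_convergent[OF incseq_C_seq] by metis
  have lim: "(\<lambda>n. (1 - A_seq a n) * x) \<longlonglongrightarrow> (1 - A) * x" for x
    by (intro tendsto_intros A)
  have "(1 - A) * r powr (- \<theta>) \<le> C"
    by (rule LIMSEQ_le[OF lim C]) (use C_seq_bounds in auto)
  moreover have "C \<le> (1 - A) * (r - 1) powr (- \<theta>)"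
    by (rule LIMSEQ_le[OF C lim]) (use C_seq_bounds in auto)
  ultimately show ?thesis
    using that C by blast
qed

text \<open>Absorption makes the events of sitting in a set of absorbing states increase in
  \<open>n\<close>; their union is the event of ever being absorbed there, so its probability is the
  limit of the explicit ones.\<close>

lemma absorption_probabilities:
  assumes A: "A_seq a \<longlonglongrightarrow> A" "0 \<le> A" and C: "C_seq a c \<longlonglongrightarrow> C" "0 \<le> C" and AC: "0 < A + C"
  shows "ext_prob M Z = gw_f \<theta> r A C 0"
    and "Delta_prob M Z = 1 - gw_f \<theta> r A C 1"
    and "absorb_prob M Z = 1 - (gw_f \<theta> r A C 1 - gw_f \<theta> r A C 0)"
proof -
  have lim: "(\<lambda>n. gw_f \<theta> r (A_seq a n) (C_seq a c n) s) \<longlonglongrightarrow> gw_f \<theta> r A C s" if "s \<le> 1" for s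
  proof (rule gw_f_tendsto[OF A(1) C(1)])
    show "0 < A * (r - s) powr (- \<theta>) + C"
      using A(2) C(2) AC r that by (cases "A = 0") (auto intro!: add_pos_nonneg)
  qed
  \<comment> \<open>One statement for absorption at 0, at \<open>None\<close>, and at
    either.\<close>
  have hit: "(\<lambda>n. prob {\<omega> \<in> space M. Z n \<omega> \<in> S}) \<longlonglongrightarrow> prob {\<omega> \<in> space M. \<exists>n. Z n \<omega> \<in> S}"
    if "S \<subseteq> {None, Some 0}" for S
  proof -
    have "incseq (\<lambda>n. {\<omega> \<in> space M. Z n \<omega> \<in> S})"
    proof (intro incseq_SucI subsetI)
      fix n \<omega>
      assume \<omega>: "\<omega> \<in> {\<omega> \<in> space M. Z n \<omega> \<in> S}"
      then have "Z (Suc n) \<omega> = Z n \<omega>"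
        using that by (intro Z_absorbing) auto
      with \<omega> show "\<omega> \<in> {\<omega> \<in> space M. Z (Suc n) \<omega> \<in> S}"
        by simp
    qed
    then have "(\<lambda>n. prob {\<omega> \<in> space M. Z n \<omega> \<in> S}) \<longlonglongrightarrow> prob (\<Union>n. {\<omega> \<in> space M. Z n \<omega> \<in> S})"
      by (intro finite_Lim_measure_incseq) auto
    moreover have "(\<Union>n. {\<omega> \<in> space M. Z n \<omega> \<in> S}) = {\<omega> \<in> space M. \<exists>n. Z n \<omega> \<in> S}"
      by auto
    ultimately show ?thesis by simp
  qed
  show "ext_prob M Z = gw_f \<theta> r A C 0"
    unfolding ext_prob_def tau_0_def hit_time_less_infinity_iff
    using hit[of "{Some 0}"] lim[of 0] by (auto simp: prob_Z_eq_0 intro: LIMSEQ_unique)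
  show "Delta_prob M Z = 1 - gw_f \<theta> r A C 1"
    unfolding Delta_prob_def tau_Delta_def hit_time_less_infinity_iff
    using hit[of "{None}"] tendsto_diff[OF tendsto_const[of 1] lim[of 1]]
    by (auto simp: prob_Z_eq_None intro: LIMSEQ_unique)
  have eq: "prob {\<omega> \<in> space M. Z n \<omega> \<in> {None, Some 0}}
      = 1 - (gw_f \<theta> r (A_seq a n) (C_seq a c n) 1 - gw_f \<theta> r (A_seq a n) (C_seq a c n) 0)" for n
  proof -
    have "{\<omega> \<in> space M. Z n \<omega> \<in> {None, Some 0}} = {\<omega> \<in> space M. Z n \<omega> = None} \<union> {\<omega> \<in> space M. Z n \<omega> = Some 0}"
      by auto
    also have "prob \<dots> = prob {\<omega> \<in> space M. Z n \<omega> = None} + prob {\<omega> \<in> space M. Z n \<omega> = Some 0}"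
      by (rule finite_measure_Union) auto
    finally show ?thesis
      by (simp add: prob_Z_eq_0 prob_Z_eq_None)
  qed
  have "(\<lambda>n. prob {\<omega> \<in> space M. Z n \<omega> \<in> {None, Some 0}})
      \<longlonglongrightarrow> 1 - (gw_f \<theta> r A C 1 - gw_f \<theta> r A C 0)"
    unfolding eq by (intro tendsto_diff tendsto_const lim) simp_all
  with hit[OF order_refl]
  have "prob {\<omega> \<in> space M. \<exists>n. Z n \<omega> \<in> {None, Some 0}} = 1 - (gw_f \<theta> r A C 1 - gw_f \<theta> r A C 0)"
    by (rule LIMSEQ_unique)
  moreover have "tau Z \<omega> < \<infinity> \<longleftrightarrow> (\<exists>n. Z n \<omega> \<in> {None, Some 0})" for \<omega>
    unfolding tau_def tau_0_def tau_Delta_def min_less_iff_disj hit_time_less_infinity_iff by auto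
  ultimately show "absorb_prob M Z = 1 - (gw_f \<theta> r A C 1 - gw_f \<theta> r A C 0)"
    by (simp only: absorb_prob_def)
qed

text \<open>The state 0 adds nothing to the mean, so both restrictions give the same value.\<close>

lemma exp_on_Z_alive:
  "exp_on M (\<lambda>\<omega>. real (the (Z n \<omega>))) (\<lambda>\<omega>. enat n < tau Z \<omega>)
    = expectation (\<lambda>\<omega>. case Z n \<omega> of None \<Rightarrow> 0 | Some k \<Rightarrow> real k)"
  "exp_on M (\<lambda>\<omega>. real (the (Z n \<omega>))) (\<lambda>\<omega>. enat n < tau_Delta Z \<omega>)
    = expectation (\<lambda>\<omega>. case Z n \<omega> of None \<Rightarrow> 0 | Some k \<Rightarrow> real k)"
  unfolding exp_on_eq_expectation
  by (rule Bochner_Integration.integral_cong; auto simp: less_tau_iff less_tau_Delta_iff split: option.split)+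

text \<open>The means converge and are therefore bounded, so the probability of a change is at most
  a constant times \<open>1 - a (Suc n)\<close>. As \<open>A_seq a n\<close> stays above
  \<open>A > 0\<close>, this is dominated by a multiple of
  \<open>A_seq a n - A_seq a (Suc n)\<close>, which telescopes.\<close>

lemma summable_prob_Z_change:
  assumes A: "A_seq a \<longlonglongrightarrow> A" "0 < A" and C: "C_seq a c \<longlonglongrightarrow> C" "0 \<le> C"
  shows "summable (\<lambda>n. prob {\<omega> \<in> space M. Z (Suc n) \<omega> \<noteq> Z n \<omega>})"
proof -
  define m where "m n = expectation (\<lambda>\<omega>. case Z n \<omega> of None \<Rightarrow> 0 | Some k \<Rightarrow> real k)" for n
  define K where "K = 1 + (1 / \<theta> + 1) * ((r - 1) powr (- \<theta>) * r powr \<theta> - 1)"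
  have pos: "0 < A * (r - 1) powr (- \<theta>) + C"
    using A C r by (simp add: add_pos_nonneg)
  have "m \<longlonglongrightarrow> A * (r - 1) powr (- \<theta> - 1) * (A * (r - 1) powr (- \<theta>) + C) powr (- 1 / \<theta> - 1)"
    unfolding m_def expectation_Z(2)
    by (intro tendsto_intros A C) (use pos in auto)
  then obtain B where B: "0 < B" "\<And>n. \<bar>m n\<bar> \<le> B"
    using convergent_imp_Bseq[OF convergentI] by (metis BseqE real_norm_def)
  have change: "prob {\<omega> \<in> space M. Z (Suc n) \<omega> \<noteq> Z n \<omega>} \<le> K * B / A * (A_seq a n - A_seq a (Suc n))" for n
  proof -
    have p1: "1 - p (Suc n) 1 \<le> K * (1 - a (Suc n))"
      unfolding K_def by (rule one_minus_prob_offspring_one_le)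
    have "0 \<le> 1 - p (Suc n) 1"
      using offspring[of "Suc n" 0 1] prob_le_1[of "{\<omega> \<in> space M. \<xi> (Suc n) 0 \<omega> = Some 1}"] by simp
    then have "0 \<le> K * (1 - a (Suc n))"
      using p1 by linarith
    \<comment> \<open>The sign of \<open>K\<close> follows from a nonnegative product with the
      strictly positive factor \<open>1 - a (Suc n)\<close>.\<close>
    then have K: "0 \<le> K"
      using a[of "Suc n"] by (simp add: zero_le_mult_iff)
    have "A \<le> A_seq a n"
      using decseq_ge[OF decseq_A_seq A(1)] .
    then have "A * (1 - a (Suc n)) \<le> A_seq a n * (1 - a (Suc n))"
      using a[of "Suc n"] by (intro mult_right_mono) auto
    then have a1: "1 - a (Suc n) \<le> (A_seq a n - A_seq a (Suc n)) / A"
      using A(2) by (simp add: A_seq_Suc field_simps)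
    have "prob {\<omega> \<in> space M. Z (Suc n) \<omega> \<noteq> Z n \<omega>} \<le> (1 - p (Suc n) 1) * m n"
      unfolding m_def by (rule prob_Z_change_le)
    also have "\<dots> \<le> (1 - p (Suc n) 1) * B"
      using B(2)[of n] \<open>0 \<le> 1 - p (Suc n) 1\<close> by (intro mult_left_mono) auto
    also have "\<dots> \<le> (K * (1 - a (Suc n))) * B"
      using p1 B(1) by (intro mult_right_mono) auto
    also have "\<dots> \<le> (K * ((A_seq a n - A_seq a (Suc n)) / A)) * B"
      using a1 K B(1) by (intro mult_right_mono mult_left_mono) auto
    finally show ?thesis by (simp add: field_simps)
  qed
  show ?thesis
  proof (rule summable_comparison_test'[where N = 0])
    show "summable (\<lambda>n. K * B / A * (A_seq a n - A_seq a (Suc n)))"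
      by (intro summable_mult telescope_summable'[OF A(1)])
    show "norm (prob {\<omega> \<in> space M. Z (Suc n) \<omega> \<noteq> Z n \<omega>}) \<le> K * B / A * (A_seq a n - A_seq a (Suc n))" for n
      using change[of n] by simp
  qed
qed

text \<open>By Borel-Cantelli almost every path is eventually constant, which is convergence in a
  discrete space. The generating function of the limit follows by dominated convergence.\<close>

lemma Z_limit:
  assumes A: "A_seq a \<longlonglongrightarrow> A" "0 < A" and C: "C_seq a c \<longlonglongrightarrow> C" "0 \<le> C"
  obtains Zinf where "Zinf \<in> measurable M (count_space UNIV)"
    and "AE \<omega> in M. eventually (\<lambda>n. Z n \<omega> = Zinf \<omega>) sequentially"
    and "\<And>s. 0 \<le> s \<Longrightarrow> s \<le> 1 \<Longrightarrow>
      expectation (\<lambda>\<omega>. case Zinf \<omega> of None \<Rightarrow> 0 | Some k \<Rightarrow> s ^ k) = gw_f \<theta> r A C s"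
proof
  define P where "P k \<omega> \<longleftrightarrow> eventually (\<lambda>n. Z n \<omega> = Some k) sequentially" for k \<omega>
  \<comment> \<open>Paths without an eventual finite value get \<open>None\<close>: those absorbed
    at \<open>None\<close> and those that never settle, the latter forming a null set. Eventual
    values are unique, so the description is proper.\<close>
  define Zinf where "Zinf \<omega> = (if \<exists>k. P k \<omega> then Some (THE k. P k \<omega>) else None)" for \<omega>
  have P_unique: "k = l" if "P k \<omega>" "P l \<omega>" for k l \<omega>
  proof -
    have "eventually (\<lambda>n. Some k = Some l) sequentially"
      using that unfolding P_def by eventually_elim simp
    then show ?thesis by simp
  qed
  have Zinf_Some: "Zinf \<omega> = Some k \<longleftrightarrow> P k \<omega>" for k \<omega>
  proof -
    have "(THE l. P l \<omega>) = k" if "P k \<omega>" for k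
      using that by (rule the_equality) (use that P_unique in blast)
    note the = this
    show ?thesis
    proof
      assume Zk: "Zinf \<omega> = Some k"
      then obtain l where l: "P l \<omega>"
        by (auto simp: Zinf_def split: if_splits)
      then have "Zinf \<omega> = Some l"
        using the[OF l] by (auto simp: Zinf_def)
      with Zk l show "P k \<omega>" by simp
    next
      assume "P k \<omega>"
      then show "Zinf \<omega> = Some k"
        using the[of k] by (auto simp: Zinf_def)
    qed
  qed
  have [measurable]: "Measurable.pred M (P k)" for k
    unfolding P_def eventually_sequentially by measurable
  show Zinf [measurable]: "Zinf \<in> measurable M (count_space UNIV)"
    unfolding measurable_count_space_eq2_countable
  proof safe
    fix z
    have "Zinf -` {z} \<inter> space M = {\<omega> \<in> space M. case z of None \<Rightarrow> \<not> (\<exists>k. P k \<omega>) | Some k \<Rightarrow> P k \<omega>}"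
    proof (cases z)
      case None
      have "Zinf \<omega> = None \<longleftrightarrow> \<not> (\<exists>k. P k \<omega>)" for \<omega>
        by (simp add: Zinf_def)
      then show ?thesis
        by (auto simp: None)
    next
      case (Some k)
      then show ?thesis by (auto simp: Zinf_Some)
    qed
    also have "\<dots> \<in> sets M"
      by (cases z) simp_all
    finally show "Zinf -` {z} \<inter> space M \<in> sets M" .
  qed simp
  have "AE \<omega> in M. eventually (\<lambda>n. \<omega> \<in> space M - {\<omega> \<in> space M. Z (Suc n) \<omega> \<noteq> Z n \<omega>}) sequentially"
    by (rule borel_cantelli_AE1) (simp_all add: emeasure_eq_measure summable_prob_Z_change[OF A C])
  then show ev: "AE \<omega> in M. eventually (\<lambda>n. Z n \<omega> = Zinf \<omega>) sequentially"
  proof eventually_elim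
    fix \<omega>
    assume "eventually (\<lambda>n. \<omega> \<in> space M - {\<omega> \<in> space M. Z (Suc n) \<omega> \<noteq> Z n \<omega>}) sequentially"
    then obtain N where N: "\<And>n. N \<le> n \<Longrightarrow> Z (Suc n) \<omega> = Z n \<omega>"
      by (auto simp: eventually_sequentially)
    have "Z n \<omega> = Z N \<omega>" if "N \<le> n" for n
      using that by (induction n rule: dec_induct) (auto simp: N)
    then have const: "eventually (\<lambda>n. Z n \<omega> = Z N \<omega>) sequentially"
      by (rule eventually_sequentiallyI)
    have "Zinf \<omega> = Z N \<omega>"
    proof (cases "Z N \<omega>")
      case (Some k)
      then show ?thesis
        using const by (simp add: Zinf_Some P_def)
    next
      case None
      have "\<not> P k \<omega>" for k
      proof
        assume "P k \<omega>"
        then have "eventually (\<lambda>n. Z n \<omega> = Some k \<and> Z n \<omega> = Z N \<omega>) sequentially"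
          unfolding P_def using const by (rule eventually_conj)
        then have "eventually (\<lambda>n. False) sequentially"
          by (rule eventually_mono) (auto simp: None)
        then show False by simp
      qed
      then show ?thesis
        by (simp add: Zinf_def None)
    qed
    then show "eventually (\<lambda>n. Z n \<omega> = Zinf \<omega>) sequentially"
      using const by simp
  qed
  fix s :: real
  assume s: "0 \<le> s" "s \<le> 1"
  have "(\<lambda>n. expectation (\<lambda>\<omega>. case Z n \<omega> of None \<Rightarrow> 0 | Some k \<Rightarrow> s ^ k)) \<longlonglongrightarrow>
      expectation (\<lambda>\<omega>. case Zinf \<omega> of None \<Rightarrow> 0 | Some k \<Rightarrow> s ^ k)"
  proof (rule integral_dominated_convergence[where w = "\<lambda>_. 1"])
    show "AE \<omega> in M. (\<lambda>n. case Z n \<omega> of None \<Rightarrow> 0 | Some k \<Rightarrow> s ^ k) \<longlonglongrightarrow> (case Zinf \<omega> of None \<Rightarrow> 0 | Some k \<Rightarrow> s ^ k)"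
      using ev
    proof eventually_elim
      case (elim \<omega>)
      then show ?case
        by (intro tendsto_eventually, elim eventually_mono) simp
    qed
    show "AE \<omega> in M. norm (case Z n \<omega> of None \<Rightarrow> 0 | Some k \<Rightarrow> s ^ k) \<le> 1" for n
      using s by (auto split: option.split simp: power_le_one)
  qed (auto intro: random_variable_case_option)
  then have "(\<lambda>n. gw_f \<theta> r (A_seq a n) (C_seq a c n) s) \<longlonglongrightarrow>
      expectation (\<lambda>\<omega>. case Zinf \<omega> of None \<Rightarrow> 0 | Some k \<Rightarrow> s ^ k)"
    by (simp only: pgf_Z[OF s])
  moreover have "(\<lambda>n. gw_f \<theta> r (A_seq a n) (C_seq a c n) s) \<longlonglongrightarrow> gw_f \<theta> r A C s"
  proof (rule gw_f_tendsto[OF A(1) C(1)])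
    show "0 < A * (r - s) powr (- \<theta>) + C"
      using A(2) C(2) r s by (simp add: add_pos_nonneg)
  qed
  ultimately show "expectation (\<lambda>\<omega>. case Zinf \<omega> of None \<Rightarrow> 0 | Some k \<Rightarrow> s ^ k) = gw_f \<theta> r A C s"
    by (rule LIMSEQ_unique)
qed

end

subsection \<open>Asymptotics of the means and of survival\<close>


context gw_theta_process
begin

text \<open>Numerators and survival probability are all of exact order \<open>A_seq a n\<close>;
  dividing each by it leaves first-order coefficients, whose ratios are the conditional
  limits.\<close>

lemma alive_asymptotics:
  assumes A: "A_seq a \<longlonglongrightarrow> 0" and C: "C_seq a c \<longlonglongrightarrow> C" "0 < C"
  shows "(\<lambda>n. inverse (A_seq a n) * prob {\<omega> \<in> space M. enat n < tau Z \<omega>})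
      \<longlonglongrightarrow> ((r - 1) powr (- \<theta>) - r powr (- \<theta>)) * inverse \<theta> * C powr (- 1 / \<theta> - 1)"
    and "(\<lambda>n. cond_exp_on M (\<lambda>\<omega>. real (the (Z n \<omega>))) (\<lambda>\<omega>. enat n < tau Z \<omega>))
      \<longlonglongrightarrow> \<theta> * (r - 1) powr (- \<theta> - 1) / ((r - 1) powr (- \<theta>) - r powr (- \<theta>))"
    and "\<And>s. 0 \<le> s \<Longrightarrow> s \<le> 1 \<Longrightarrow>
      (\<lambda>n. cond_exp_on M (\<lambda>\<omega>. s ^ the (Z n \<omega>)) (\<lambda>\<omega>. enat n < tau Z \<omega>))
      \<longlonglongrightarrow> ((r - s) powr (- \<theta>) - r powr (- \<theta>)) / ((r - 1) powr (- \<theta>) - r powr (- \<theta>))"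
proof -
  \<comment> \<open>The product \<open>d * e\<close> is the limit of the rescaled survival
    probability; \<open>e\<close> is common to all the limits and drops out of the ratios.\<close>
  define d where "d = (r - 1) powr (- \<theta>) - r powr (- \<theta>)"
  define e where "e = inverse \<theta> * C powr (- 1 / \<theta> - 1)"
  have d: "d \<noteq> 0"
    using powr_less_mono2_neg[of "- \<theta>" "r - 1" r] theta r by (simp add: d_def)
  have e: "e \<noteq> 0"
    using C theta by (simp add: e_def)
  have quot: "(\<lambda>n. inverse (A_seq a n) *
      (gw_f \<theta> r (A_seq a n) (C_seq a c n) s - gw_f \<theta> r (A_seq a n) (C_seq a c n) 0))
      \<longlonglongrightarrow> ((r - s) powr (- \<theta>) - r powr (- \<theta>)) * e" if "0 \<le> s" "s \<le> 1" for s
    using gw_f_difference_quotient_tendsto[of \<theta> 0 s r "A_seq a" "C_seq a c" C]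
      that theta r A C A_seq_pos C_seq_nonneg
    by (simp add: e_def mult.assoc)
  have prob: "(\<lambda>n. inverse (A_seq a n) * prob {\<omega> \<in> space M. enat n < tau Z \<omega>}) \<longlonglongrightarrow> d * e"
    unfolding prob_tau_greater d_def by (rule quot) simp_all
  then show "(\<lambda>n. inverse (A_seq a n) * prob {\<omega> \<in> space M. enat n < tau Z \<omega>})
      \<longlonglongrightarrow> ((r - 1) powr (- \<theta>) - r powr (- \<theta>)) * inverse \<theta> * C powr (- 1 / \<theta> - 1)"
    by (simp add: d_def e_def mult.assoc)
  have cond: "(\<lambda>n. cond_exp_on M (X n) (\<lambda>\<omega>. enat n < tau Z \<omega>)) \<longlonglongrightarrow> l / (d * e)"
    if "(\<lambda>n. inverse (A_seq a n) * exp_on M (X n) (\<lambda>\<omega>. enat n < tau Z \<omega>)) \<longlonglongrightarrow> l" for X l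
  proof -
    have "cond_exp_on M (X n) (\<lambda>\<omega>. enat n < tau Z \<omega>)
        = inverse (A_seq a n) * exp_on M (X n) (\<lambda>\<omega>. enat n < tau Z \<omega>)
          / (inverse (A_seq a n) * prob {\<omega> \<in> space M. enat n < tau Z \<omega>})" for n
      using A_seq_pos[of n] by (simp add: cond_exp_on_def)
    then show ?thesis
      using tendsto_divide[OF that prob] d e by simp
  qed
  show "(\<lambda>n. cond_exp_on M (\<lambda>\<omega>. real (the (Z n \<omega>))) (\<lambda>\<omega>. enat n < tau Z \<omega>))
      \<longlonglongrightarrow> \<theta> * (r - 1) powr (- \<theta> - 1) / ((r - 1) powr (- \<theta>) - r powr (- \<theta>))"
  proof -
    have "inverse (A_seq a n) * exp_on M (\<lambda>\<omega>. real (the (Z n \<omega>))) (\<lambda>\<omega>. enat n < tau Z \<omega>)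
        = (r - 1) powr (- \<theta> - 1) * (A_seq a n * (r - 1) powr (- \<theta>) + C_seq a c n) powr (- 1 / \<theta> - 1)" for n
      using A_seq_pos[of n] by (simp add: exp_on_Z_alive expectation_Z)
    moreover have "(\<lambda>n. (r - 1) powr (- \<theta> - 1) * (A_seq a n * (r - 1) powr (- \<theta>) + C_seq a c n) powr (- 1 / \<theta> - 1))
        \<longlonglongrightarrow> (r - 1) powr (- \<theta> - 1) * (0 * (r - 1) powr (- \<theta>) + C) powr (- 1 / \<theta> - 1)"
      by (intro tendsto_intros A C) (use C in auto)
    \<comment> \<open>The rescaled mean carries no \<open>inverse \<theta>\<close> whereas
      \<open>e\<close> does, which is where the factor \<open>\<theta>\<close> in the conditional
      mean comes from.\<close>
    moreover have "(r - 1) powr (- \<theta> - 1) * (0 * (r - 1) powr (- \<theta>) + C) powr (- 1 / \<theta> - 1)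
        = \<theta> * (r - 1) powr (- \<theta> - 1) * e"
      using theta by (simp add: e_def)
    ultimately have "(\<lambda>n. inverse (A_seq a n) * exp_on M (\<lambda>\<omega>. real (the (Z n \<omega>))) (\<lambda>\<omega>. enat n < tau Z \<omega>))
        \<longlonglongrightarrow> \<theta> * (r - 1) powr (- \<theta> - 1) * e"
      by (simp only:)
    from cond[OF this] e show ?thesis
      by (simp add: d_def)
  qed
  fix s :: real
  assume s: "0 \<le> s" "s \<le> 1"
  show "(\<lambda>n. cond_exp_on M (\<lambda>\<omega>. s ^ the (Z n \<omega>)) (\<lambda>\<omega>. enat n < tau Z \<omega>))
      \<longlonglongrightarrow> ((r - s) powr (- \<theta>) - r powr (- \<theta>)) / ((r - 1) powr (- \<theta>) - r powr (- \<theta>))"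
    using cond[of "\<lambda>n \<omega>. s ^ the (Z n \<omega>)", unfolded exp_on_eq_expectation pgf_Z_alive[OF s], OF quot[OF s]] e
    by (simp add: d_def)
qed

text \<open>The limit of the derivatives at 1 takes the stated form once
  \<open>(r - 1) powr (- \<theta>)\<close> is factored out of the base, by
  \<open>powr_rescale\<close>.\<close>

lemma mean_tendsto:
  assumes A: "A_seq a \<longlonglongrightarrow> A" "0 < A" and C: "C_seq a c \<longlonglongrightarrow> C" "0 \<le> C"
  shows "(\<lambda>n. exp_on M (\<lambda>\<omega>. real (the (Z n \<omega>))) (\<lambda>\<omega>. enat n < tau_Delta Z \<omega>))
    \<longlonglongrightarrow> A * (A + C * (r - 1) powr \<theta>) powr (- 1 / \<theta> - 1)"
proof -
  have pos: "0 < A * (r - 1) powr (- \<theta>) + C"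
    using A C r by (simp add: add_pos_nonneg)
  have "(\<lambda>n. A_seq a n * (r - 1) powr (- \<theta> - 1) * (A_seq a n * (r - 1) powr (- \<theta>) + C_seq a c n) powr (- 1 / \<theta> - 1))
      \<longlonglongrightarrow> A * (r - 1) powr (- \<theta> - 1) * (A * (r - 1) powr (- \<theta>) + C) powr (- 1 / \<theta> - 1)"
    by (intro tendsto_intros A C) (use pos in auto)
  moreover have "A * (r - 1) powr (- \<theta>) + C = (r - 1) powr (- \<theta>) * (A + C * (r - 1) powr \<theta>)"
    using r by (simp add: algebra_simps flip: powr_add)
  moreover have "(r - 1) powr (- \<theta> - 1) * ((r - 1) powr (- \<theta>) * (A + C * (r - 1) powr \<theta>)) powr (- 1 / \<theta> - 1)
      = (A + C * (r - 1) powr \<theta>) powr (- 1 / \<theta> - 1)"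
    by (rule powr_rescale) (use r theta A C in auto)
  ultimately show ?thesis
    by (simp only: exp_on_Z_alive expectation_Z mult.assoc)
qed

end

section \<open>The regimes of vanishing and of positive limit \<open>A\<close>\<close>

theorem theorem7:
  fixes M :: "'w measure"
    and \<theta> r :: real
    and a c :: "nat \<Rightarrow> real"
    and p :: "nat \<Rightarrow> nat \<Rightarrow> real"
    and \<xi> :: "nat \<Rightarrow> nat \<Rightarrow> 'w \<Rightarrow> nat option"
    and Z :: "nat \<Rightarrow> 'w \<Rightarrow> nat option"
  assumes "gw_theta_process M \<theta> r a c p \<xi> Z"
  shows "\<exists>A C.
    A_seq a \<longlonglongrightarrow> A \<and> 0 \<le> A \<and> A < 1 \<and>
    C_seq a c \<longlonglongrightarrow> C \<and>
    (1 - A) * r powr (- \<theta>) \<le> C \<and> C \<le> (1 - A) * (r - 1) powr (- \<theta>) \<and>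
    ext_prob M Z = r - (A * r powr (- \<theta>) + C) powr (- 1 / \<theta>) \<and>
    Delta_prob M Z = 1 - r + (A * (r - 1) powr (- \<theta>) + C) powr (- 1 / \<theta>) \<and>
    (A = 0 \<longrightarrow>
      ext_prob M Z = 1 - Delta_prob M Z \<and>
      ext_prob M Z = r - C powr (- 1 / \<theta>) \<and>
      r - C powr (- 1 / \<theta>) \<in> {0..1} \<and>
      absorb_prob M Z = 1 \<and>
      (\<lambda>n. inverse (A_seq a n) * measure M {\<omega> \<in> space M. tau Z \<omega> > enat n})
        \<longlonglongrightarrow> ((r - 1) powr (- \<theta>) - r powr (- \<theta>)) * inverse \<theta> * C powr (- 1 / \<theta> - 1) \<and>
      (\<lambda>n. cond_exp_on M (\<lambda>\<omega>. real (the (Z n \<omega>))) (\<lambda>\<omega>. tau Z \<omega> > enat n))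
        \<longlonglongrightarrow> \<theta> * (r - 1) powr (- \<theta> - 1) / ((r - 1) powr (- \<theta>) - r powr (- \<theta>)) \<and>
      (\<forall>s. 0 \<le> s \<and> s \<le> 1 \<longrightarrow>
        (\<lambda>n. cond_exp_on M (\<lambda>\<omega>. s ^ the (Z n \<omega>)) (\<lambda>\<omega>. tau Z \<omega> > enat n))
          \<longlonglongrightarrow> ((r - s) powr (- \<theta>) - r powr (- \<theta>))
                / ((r - 1) powr (- \<theta>) - r powr (- \<theta>)))) \<and>
    (0 < A \<and> A < 1 \<longrightarrow>
      0 \<le> absorb_prob M Z \<and> absorb_prob M Z < 1 \<and>
      (\<lambda>n. exp_on M (\<lambda>\<omega>. real (the (Z n \<omega>))) (\<lambda>\<omega>. tau_Delta Z \<omega> > enat n))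
        \<longlonglongrightarrow> A * (A + C * (r - 1) powr \<theta>) powr (- 1 / \<theta> - 1) \<and>
      (\<exists>Zinf :: 'w \<Rightarrow> nat option.
        Zinf \<in> measurable M (count_space UNIV) \<and>
        (AE \<omega> in M. limitin (discrete_topology UNIV) (\<lambda>n. Z n \<omega>) (Zinf \<omega>) sequentially) \<and>
        measure M {\<omega> \<in> space M. Zinf \<omega> = None}
          = 1 - r + (A * (r - 1) powr (- \<theta>) + C) powr (- 1 / \<theta>) \<and>
        (\<forall>s. 0 \<le> s \<and> s \<le> 1 \<longrightarrow>
          exp_on M (\<lambda>\<omega>. s ^ the (Zinf \<omega>)) (\<lambda>\<omega>. Zinf \<omega> \<noteq> None)
            = r - (A * (r - s) powr (- \<theta>) + C) powr (- 1 / \<theta>))))"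
proof -
  interpret gw_theta_process M \<theta> r a c p \<xi> Z by fact
  obtain A where A: "A_seq a \<longlonglongrightarrow> A" "0 \<le> A" "A < 1"
    using A_seq_limit by blast
  obtain C where C: "C_seq a c \<longlonglongrightarrow> C"
    and C_ge: "(1 - A) * r powr (- \<theta>) \<le> C" and C_le: "C \<le> (1 - A) * (r - 1) powr (- \<theta>)"
    using C_seq_limit[OF A(1)] by blast
  \<comment> \<open>Because \<open>A < 1\<close>, the lower bound for \<open>C\<close> is positive;
    this keeps the bases of the powers away from 0 even when \<open>A = 0\<close>.\<close>
  have "0 < (1 - A) * r powr (- \<theta>)"
    using A r by simp
  with C_ge have C_pos: "0 < C" by linarith
  have abs: "ext_prob M Z = gw_f \<theta> r A C 0" "Delta_prob M Z = 1 - gw_f \<theta> r A C 1"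
    "absorb_prob M Z = 1 - (gw_f \<theta> r A C 1 - gw_f \<theta> r A C 0)"
    using absorption_probabilities[OF A(1,2) C] A(2) C_pos by simp_all
  have ext: "ext_prob M Z = r - (A * r powr (- \<theta>) + C) powr (- 1 / \<theta>)"
    and Delta: "Delta_prob M Z = 1 - r + (A * (r - 1) powr (- \<theta>) + C) powr (- 1 / \<theta>)"
    by (simp_all add: abs gw_f_def)
  show ?thesis
  proof (rule exI[of _ A], rule exI[of _ C], intro conjI impI A C C_ge C_le ext Delta allI; (elim conjE)?)
    assume [simp]: "A = 0"
    show "ext_prob M Z = 1 - Delta_prob M Z" "ext_prob M Z = r - C powr (- 1 / \<theta>)" "absorb_prob M Z = 1"
      by (simp_all add: abs gw_f_def)
    \<comment> \<open>The range of the explicit expression is obtained from its being a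
      probability.\<close>
    moreover have "ext_prob M Z \<in> {0..1}"
      unfolding ext_prob_def atLeastAtMost_iff by (intro conjI measure_nonneg prob_le_1)
    ultimately show "r - C powr (- 1 / \<theta>) \<in> {0..1}"
      by (simp only:)
    have A0: "A_seq a \<longlonglongrightarrow> 0" using A by simp
    note asym = alive_asymptotics[OF A0 C C_pos]
    show "(\<lambda>n. inverse (A_seq a n) * measure M {\<omega> \<in> space M. tau Z \<omega> > enat n})
        \<longlonglongrightarrow> ((r - 1) powr (- \<theta>) - r powr (- \<theta>)) * inverse \<theta> * C powr (- 1 / \<theta> - 1)"
      by (rule asym)
    show "(\<lambda>n. cond_exp_on M (\<lambda>\<omega>. real (the (Z n \<omega>))) (\<lambda>\<omega>. tau Z \<omega> > enat n))
        \<longlonglongrightarrow> \<theta> * (r - 1) powr (- \<theta> - 1) / ((r - 1) powr (- \<theta>) - r powr (- \<theta>))"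
      by (rule asym)
    show "(\<lambda>n. cond_exp_on M (\<lambda>\<omega>. s ^ the (Z n \<omega>)) (\<lambda>\<omega>. tau Z \<omega> > enat n))
          \<longlonglongrightarrow> ((r - s) powr (- \<theta>) - r powr (- \<theta>))
                / ((r - 1) powr (- \<theta>) - r powr (- \<theta>))" if "0 \<le> s" "s \<le> 1" for s
      using that by (rule asym)
  next
    assume A_pos: "0 < A"
    show "0 \<le> absorb_prob M Z"
      by (simp add: absorb_prob_def)
    \<comment> \<open>Strictness rests on \<open>A > 0\<close> and is reversed by the negative power
      \<open>- 1 / \<theta>\<close>, so survival keeps positive probability.\<close>
    have "A * r powr (- \<theta>) + C < A * (r - 1) powr (- \<theta>) + C"
      using powr_less_mono2_neg[of "- \<theta>" "r - 1" r] theta r A_pos by simp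
    then have "(A * (r - 1) powr (- \<theta>) + C) powr (- 1 / \<theta>) < (A * r powr (- \<theta>) + C) powr (- 1 / \<theta>)"
      by (intro powr_less_mono2_neg) (use theta A_pos C_pos r in \<open>auto simp: add_pos_pos\<close>)
    then show "absorb_prob M Z < 1"
      by (simp add: abs gw_f_def)
    show "(\<lambda>n. exp_on M (\<lambda>\<omega>. real (the (Z n \<omega>))) (\<lambda>\<omega>. tau_Delta Z \<omega> > enat n))
        \<longlonglongrightarrow> A * (A + C * (r - 1) powr \<theta>) powr (- 1 / \<theta> - 1)"
      using A(1) A_pos C C_pos by (intro mean_tendsto) auto
    obtain Zinf where Zinf: "Zinf \<in> measurable M (count_space UNIV)"
      and conv: "AE \<omega> in M. eventually (\<lambda>n. Z n \<omega> = Zinf \<omega>) sequentially"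
      and pgf_Zinf: "\<And>s. 0 \<le> s \<Longrightarrow> s \<le> 1 \<Longrightarrow>
        expectation (\<lambda>\<omega>. case Zinf \<omega> of None \<Rightarrow> 0 | Some k \<Rightarrow> s ^ k) = gw_f \<theta> r A C s"
      using Z_limit[OF A(1) A_pos C less_imp_le[OF C_pos]] by blast
    have exp: "exp_on M (\<lambda>\<omega>. s ^ the (Zinf \<omega>)) (\<lambda>\<omega>. Zinf \<omega> \<noteq> None)
        = r - (A * (r - s) powr (- \<theta>) + C) powr (- 1 / \<theta>)" if "0 \<le> s" "s \<le> 1" for s
    proof -
      have "exp_on M (\<lambda>\<omega>. s ^ the (Zinf \<omega>)) (\<lambda>\<omega>. Zinf \<omega> \<noteq> None)
          = expectation (\<lambda>\<omega>. case Zinf \<omega> of None \<Rightarrow> 0 | Some k \<Rightarrow> s ^ k)"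
        unfolding exp_on_eq_expectation by (rule Bochner_Integration.integral_cong) (auto split: option.split)
      then show ?thesis
        using pgf_Zinf[OF that] by (simp add: gw_f_def)
    qed
    \<comment> \<open>The mass at \<open>None\<close> is the defect of the limiting generating
      function at \<open>s = 1\<close>.\<close>
    have "prob {\<omega> \<in> space M. Zinf \<omega> \<noteq> None} = exp_on M (\<lambda>\<omega>. 1 ^ the (Zinf \<omega>)) (\<lambda>\<omega>. Zinf \<omega> \<noteq> None)"
      unfolding exp_on_eq_expectation power_one using Zinf by (intro prob_eq_expectation) measurable
    then have "prob {\<omega> \<in> space M. Zinf \<omega> = None} = 1 - r + (A * (r - 1) powr (- \<theta>) + C) powr (- 1 / \<theta>)"
      using exp[of 1] prob_neg[of "\<lambda>\<omega>. Zinf \<omega> \<noteq> None"] Zinf by simp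
    moreover have "AE \<omega> in M. limitin (discrete_topology UNIV) (\<lambda>n. Z n \<omega>) (Zinf \<omega>) sequentially"
      using conv by eventually_elim (auto simp: limitin_def elim: eventually_mono)
    ultimately show "\<exists>Zinf :: 'w \<Rightarrow> nat option.
        Zinf \<in> measurable M (count_space UNIV) \<and>
        (AE \<omega> in M. limitin (discrete_topology UNIV) (\<lambda>n. Z n \<omega>) (Zinf \<omega>) sequentially) \<and>
        measure M {\<omega> \<in> space M. Zinf \<omega> = None}
          = 1 - r + (A * (r - 1) powr (- \<theta>) + C) powr (- 1 / \<theta>) \<and>
        (\<forall>s. 0 \<le> s \<and> s \<le> 1 \<longrightarrow>
          exp_on M (\<lambda>\<omega>. s ^ the (Zinf \<omega>)) (\<lambda>\<omega>. Zinf \<omega> \<noteq> None)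
            = r - (A * (r - s) powr (- \<theta>) + C) powr (- 1 / \<theta>))"
      using Zinf exp by blast
  qed
qed

end
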